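(* Let $T:\mathcal A\to\mathsf{Mnd}(\mathcal X)$ be a parametrized monad. The Eilenberg--Moore fibration $p^T:\mathcal A\ltimes^T\mathcal X\to\mathcal A$ is equivalent, in the slice 2-category $\mathsf{Cat}/\mathcal A$, to the composite $$\mathsf{EM}(\hat T)\xrightarrow{\ U^{\hat T}\ }\mathcal A\times\mathcal X\xrightarrow{\ \pi_{\mathcal A}\ }\mathcal A,$$ where $U^{\hat T}$ is the forgetful functor from the category of Eilenberg--Moore algebras of the monad $$\hat T:\mathcal A\times\mathcal X\to\mathcal A\times\mathcal X,\qquad (A,X)\mapsto(A,T_AX).$$ Moreover, $p^T:\mathcal A\ltimes^T\mathcal X\to\mathcal A$ is the (internal) Eilenberg--Moore object, in the slice 2-category $\mathsf{Cat}/\mathcal A$, of the monad $\hat T$ on the object $\pi_{\mathcal A}:\mathcal A\times\mathcal X\to\mathcal A$.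
   Context: A parametrized monad with parameters $\mathcal A$ and carriers $\mathcal X$ is a functor $T:\mathcal A\to\mathsf{Mnd}(\mathcal X)$, $A\mapsto T_A$, into the category of monads on $\mathcal X$ and monad morphisms (natural transformations compatible with units and multiplications). $\mathcal A\ltimes^T\mathcal X$ is the category with objects $(A,X,\xi)$, where $A\in\mathcal A$ and $\xi:T_AX\to X$ is an Eilenberg--Moore algebra of $T_A$, and morphisms $(A,X,\xi)\to(B,Y,\theta)$ the pairs $(f:A\to B,\ g:X\to Y)$ with $g\circ\xi=\theta\circ T(f,g)$, where $T(f,g):T_AX\to T_BY$. The fibration $p^T$ sends $(A,X,\xi)$ to $A$. The slice 2-category $\mathsf{Cat}/\mathcal A$ has functors into $\mathcal A$ as objects; its 1-cells are functors making the triangle over $\mathcal A$ commute (the paper only asks for commutation up to a specified isomorphism), and its 2-cells are natural transformations compatible with the projections to $\mathcal A$. The monad $\hat T$ has unit and multiplication induced componentwise from those of the $T_A$, and it is a monad in $\mathsf{Cat}/\mathcal A$ on $\pi_{\mathcal A}$. The Eilenberg--Moore object of a monad $t$ on an object $c$ in a 2-category is the object representing, for each object $g$, the category of $t$-modules $(m:g\to c,\ \lambda:t\circ m\Rightarrow m)$ satisfying the unit and associativity laws. *)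

theory Defs
  imports "HOL-Library.FuncSet"
begin

section \<open>Categories, functors, natural transformations\<close>

text \<open>Functors and natural transformations are required to be extensional, i.e. \<^const>\<open>undefined\<close>
  off the objects and arrows of their source, so that HOL equality of them is equality in the
  sense of category theory.\<close>

record ('o, 'm) cat =
  Obj :: "'o set"
  Arr :: "'m set"
  Dom :: "'m \<Rightarrow> 'o"
  Cod :: "'m \<Rightarrow> 'o"
  Id :: "'o \<Rightarrow> 'm"
  Comp :: "'m \<Rightarrow> 'm \<Rightarrow> 'm"

definition hom :: "('o, 'm) cat \<Rightarrow> 'o \<Rightarrow> 'o \<Rightarrow> 'm set" where
  "hom C a b = {f \<in> Arr C. Dom C f = a \<and> Cod C f = b}"

definition category :: "('o, 'm) cat \<Rightarrow> bool" where
  "category C \<longleftrightarrow>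
     (\<forall>f\<in>Arr C. Dom C f \<in> Obj C \<and> Cod C f \<in> Obj C) \<and>
     (\<forall>a\<in>Obj C. Id C a \<in> hom C a a) \<and>
     (\<forall>f\<in>Arr C. \<forall>g\<in>Arr C. Dom C g = Cod C f \<longrightarrow> Comp C g f \<in> hom C (Dom C f) (Cod C g)) \<and>
     (\<forall>f\<in>Arr C. Comp C f (Id C (Dom C f)) = f \<and> Comp C (Id C (Cod C f)) f = f) \<and>
     (\<forall>f\<in>Arr C. \<forall>g\<in>Arr C. \<forall>h\<in>Arr C. Dom C g = Cod C f \<longrightarrow> Dom C h = Cod C g \<longrightarrow>
        Comp C h (Comp C g f) = Comp C (Comp C h g) f)"

definition inverse_arrows :: "('o, 'm) cat \<Rightarrow> 'm \<Rightarrow> 'm \<Rightarrow> bool" where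
  "inverse_arrows C f g \<longleftrightarrow>
     f \<in> Arr C \<and> g \<in> hom C (Cod C f) (Dom C f) \<and>
     Comp C g f = Id C (Dom C f) \<and> Comp C f g = Id C (Cod C f)"

definition iso_arrow :: "('o, 'm) cat \<Rightarrow> 'm \<Rightarrow> bool" where
  "iso_arrow C f \<longleftrightarrow> (\<exists>g. inverse_arrows C f g)"

definition isomorphic :: "('o, 'm) cat \<Rightarrow> 'o \<Rightarrow> 'o \<Rightarrow> bool" where
  "isomorphic C a b \<longleftrightarrow> (\<exists>f\<in>hom C a b. iso_arrow C f)"

definition prod_cat :: "('a, 'f) cat \<Rightarrow> ('x, 'm) cat \<Rightarrow> ('a \<times> 'x, 'f \<times> 'm) cat" where
  "prod_cat C D =
    \<lparr>Obj = Obj C \<times> Obj D, Arr = Arr C \<times> Arr D,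
     Dom = (\<lambda>(f, g). (Dom C f, Dom D g)), Cod = (\<lambda>(f, g). (Cod C f, Cod D g)),
     Id = (\<lambda>(a, x). (Id C a, Id D x)),
     Comp = (\<lambda>(f', g') (f, g). (Comp C f' f, Comp D g' g))\<rparr>"

record ('o, 'm, 'p, 'n) fnctr =
  fobj :: "'o \<Rightarrow> 'p"
  farr :: "'m \<Rightarrow> 'n"

definition is_functor ::
  "('o, 'm) cat \<Rightarrow> ('p, 'n) cat \<Rightarrow> ('o, 'm, 'p, 'n) fnctr \<Rightarrow> bool" where
  "is_functor C D F \<longleftrightarrow> category C \<and> category D \<and>
     fobj F \<in> Obj C \<rightarrow>\<^sub>E Obj D \<and> farr F \<in> Arr C \<rightarrow>\<^sub>E Arr D \<and>
     (\<forall>f\<in>Arr C. farr F f \<in> hom D (fobj F (Dom C f)) (fobj F (Cod C f))) \<and>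
     (\<forall>a\<in>Obj C. farr F (Id C a) = Id D (fobj F a)) \<and>
     (\<forall>f\<in>Arr C. \<forall>g\<in>Arr C. Dom C g = Cod C f \<longrightarrow>
        farr F (Comp C g f) = Comp D (farr F g) (farr F f))"

definition functor_id :: "('o, 'm) cat \<Rightarrow> ('o, 'm, 'o, 'm) fnctr" where
  "functor_id C = \<lparr>fobj = (\<lambda>a\<in>Obj C. a), farr = (\<lambda>f\<in>Arr C. f)\<rparr>"

text \<open>In \<open>functor_comp C G F\<close>, as in the operations on transformations below, \<open>C\<close> is the category on
  which the result lives; it is needed to make the result extensional.\<close>

definition functor_comp ::
  "('o, 'm) cat \<Rightarrow> ('p, 'n, 'q, 'r) fnctr \<Rightarrow> ('o, 'm, 'p, 'n) fnctr \<Rightarrow> ('o, 'm, 'q, 'r) fnctr"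
  where
  "functor_comp C G F = \<lparr>fobj = (\<lambda>a\<in>Obj C. fobj G (fobj F a)), farr = (\<lambda>f\<in>Arr C. farr G (farr F f))\<rparr>"

definition cat_isomorphism ::
  "('o, 'm) cat \<Rightarrow> ('p, 'n) cat \<Rightarrow> ('o, 'm, 'p, 'n) fnctr \<Rightarrow> bool" where
  "cat_isomorphism C D F \<longleftrightarrow> is_functor C D F \<and>
     (\<exists>G. is_functor D C G \<and> functor_comp C G F = functor_id C \<and> functor_comp D F G = functor_id D)"

definition proj1 :: "('a, 'f) cat \<Rightarrow> ('x, 'm) cat \<Rightarrow> ('a \<times> 'x, 'f \<times> 'm, 'a, 'f) fnctr" where
  "proj1 C D = \<lparr>fobj = (\<lambda>a\<in>Obj (prod_cat C D). fst a), farr = (\<lambda>f\<in>Arr (prod_cat C D). fst f)\<rparr>"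

definition nat_trans ::
  "('o, 'm) cat \<Rightarrow> ('p, 'n) cat \<Rightarrow> ('o, 'm, 'p, 'n) fnctr \<Rightarrow> ('o, 'm, 'p, 'n) fnctr \<Rightarrow>
   ('o \<Rightarrow> 'n) \<Rightarrow> bool" where
  "nat_trans C D F G \<alpha> \<longleftrightarrow> is_functor C D F \<and> is_functor C D G \<and>
     \<alpha> \<in> extensional (Obj C) \<and>
     (\<forall>a\<in>Obj C. \<alpha> a \<in> hom D (fobj F a) (fobj G a)) \<and>
     (\<forall>f\<in>Arr C. Comp D (\<alpha> (Cod C f)) (farr F f) = Comp D (farr G f) (\<alpha> (Dom C f)))"

definition nat_iso ::
  "('o, 'm) cat \<Rightarrow> ('p, 'n) cat \<Rightarrow> ('o, 'm, 'p, 'n) fnctr \<Rightarrow> ('o, 'm, 'p, 'n) fnctr \<Rightarrow>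
   ('o \<Rightarrow> 'n) \<Rightarrow> bool" where
  "nat_iso C D F G \<alpha> \<longleftrightarrow> nat_trans C D F G \<alpha> \<and> (\<forall>a\<in>Obj C. iso_arrow D (\<alpha> a))"

definition nat_id ::
  "('o, 'm) cat \<Rightarrow> ('p, 'n) cat \<Rightarrow> ('o, 'm, 'p, 'n) fnctr \<Rightarrow> 'o \<Rightarrow> 'n" where
  "nat_id C D F = (\<lambda>a\<in>Obj C. Id D (fobj F a))"

definition vcomp ::
  "('o, 'm) cat \<Rightarrow> ('p, 'n) cat \<Rightarrow> ('o \<Rightarrow> 'n) \<Rightarrow> ('o \<Rightarrow> 'n) \<Rightarrow> 'o \<Rightarrow> 'n" where
  "vcomp C D \<beta> \<alpha> = (\<lambda>a\<in>Obj C. Comp D (\<beta> a) (\<alpha> a))"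

text \<open>The whiskerings \<open>G\<alpha>\<close> and \<open>\<alpha>F\<close>.\<close>

definition lwhisk ::
  "('o, 'm) cat \<Rightarrow> ('p, 'n, 'q, 'r) fnctr \<Rightarrow> ('o \<Rightarrow> 'n) \<Rightarrow> 'o \<Rightarrow> 'r" where
  "lwhisk C G \<alpha> = (\<lambda>a\<in>Obj C. farr G (\<alpha> a))"

definition rwhisk ::
  "('o, 'm) cat \<Rightarrow> ('p \<Rightarrow> 'r) \<Rightarrow> ('o, 'm, 'p, 'n) fnctr \<Rightarrow> 'o \<Rightarrow> 'r" where
  "rwhisk C \<alpha> F = (\<lambda>a\<in>Obj C. \<alpha> (fobj F a))"


section \<open>Monads and parametrized monads\<close>

record ('o, 'm) mnd =
  mfun :: "('o, 'm, 'o, 'm) fnctr"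
  munit :: "'o \<Rightarrow> 'm"
  mmult :: "'o \<Rightarrow> 'm"

definition is_monad :: "('o, 'm) cat \<Rightarrow> ('o, 'm) mnd \<Rightarrow> bool" where
  "is_monad C M \<longleftrightarrow>
     (let T = mfun M; \<eta> = munit M; \<mu> = mmult M in
      is_functor C C T \<and> nat_trans C C (functor_id C) T \<eta> \<and> nat_trans C C (functor_comp C T T) T \<mu> \<and>
      vcomp C C \<mu> (rwhisk C \<eta> T) = nat_id C C T \<and>
      vcomp C C \<mu> (lwhisk C T \<eta>) = nat_id C C T \<and>
      vcomp C C \<mu> (rwhisk C \<mu> T) = vcomp C C \<mu> (lwhisk C T \<mu>))"

definition monad_morphism ::
  "('o, 'm) cat \<Rightarrow> ('o, 'm) mnd \<Rightarrow> ('o, 'm) mnd \<Rightarrow> ('o \<Rightarrow> 'm) \<Rightarrow> bool" where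
  "monad_morphism C M N \<alpha> \<longleftrightarrow> is_monad C M \<and> is_monad C N \<and>
     nat_trans C C (mfun M) (mfun N) \<alpha> \<and>
     vcomp C C \<alpha> (munit M) = munit N \<and>
     vcomp C C \<alpha> (mmult M) =
       vcomp C C (mmult N) (vcomp C C (rwhisk C \<alpha> (mfun N)) (lwhisk C (mfun M) \<alpha>))"

definition Mnd ::
  "('o, 'm) cat \<Rightarrow> (('o, 'm) mnd, ('o, 'm) mnd \<times> ('o \<Rightarrow> 'm) \<times> ('o, 'm) mnd) cat" where
  "Mnd C =
    \<lparr>Obj = {M. is_monad C M}, Arr = {(M, \<alpha>, N). monad_morphism C M N \<alpha>},
     Dom = (\<lambda>(M, \<alpha>, N). M), Cod = (\<lambda>(M, \<alpha>, N). N),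
     Id = (\<lambda>M. (M, nat_id C C (mfun M), M)),
     Comp = (\<lambda>(N, \<beta>, P) (M, \<alpha>, N'). (M, vcomp C C \<beta> \<alpha>, P))\<rparr>"

type_synonym ('a, 'f, 'x, 'm) param_monad =
  "('a, 'f, ('x, 'm) mnd, ('x, 'm) mnd \<times> ('x \<Rightarrow> 'm) \<times> ('x, 'm) mnd) fnctr"

definition parametrized_monad ::
  "('a, 'f) cat \<Rightarrow> ('x, 'm) cat \<Rightarrow> ('a, 'f, 'x, 'm) param_monad \<Rightarrow> bool" where
  "parametrized_monad A X T \<longleftrightarrow> is_functor A (Mnd X) T"

text \<open>\<open>T(f, g) : T\<^sub>A X \<rightarrow> T\<^sub>B Y\<close> for \<open>f : A \<rightarrow> B\<close> and \<open>g : X \<rightarrow> Y\<close> is \<open>(T\<^sub>f)\<^sub>Y \<circ> T\<^sub>A(g)\<close>.\<close>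

definition pm_map ::
  "('a, 'f) cat \<Rightarrow> ('x, 'm) cat \<Rightarrow> ('a, 'f, 'x, 'm) param_monad \<Rightarrow> 'f \<Rightarrow> 'm \<Rightarrow> 'm" where
  "pm_map A X T f g =
     Comp X (fst (snd (farr T f)) (Cod X g)) (farr (mfun (fobj T (Dom A f))) g)"

definition That ::
  "('a, 'f) cat \<Rightarrow> ('x, 'm) cat \<Rightarrow> ('a, 'f, 'x, 'm) param_monad \<Rightarrow> ('a \<times> 'x, 'f \<times> 'm) mnd" where
  "That A X T =
    \<lparr>mfun =
       \<lparr>fobj = (\<lambda>(a, x)\<in>Obj (prod_cat A X). (a, fobj (mfun (fobj T a)) x)),
        farr = (\<lambda>(f, g)\<in>Arr (prod_cat A X). (f, pm_map A X T f g))\<rparr>,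
     munit = (\<lambda>(a, x)\<in>Obj (prod_cat A X). (Id A a, munit (fobj T a) x)),
     mmult = (\<lambda>(a, x)\<in>Obj (prod_cat A X). (Id A a, mmult (fobj T a) x))\<rparr>"


section \<open>Eilenberg--Moore algebras\<close>

text \<open>Arrows carry their source and target, since an underlying arrow can be a homomorphism for
  several pairs of algebra structures.\<close>

definition EM_algebra :: "('o, 'm) cat \<Rightarrow> ('o, 'm) mnd \<Rightarrow> 'o \<Rightarrow> 'm \<Rightarrow> bool" where
  "EM_algebra C M x \<xi> \<longleftrightarrow> x \<in> Obj C \<and> \<xi> \<in> hom C (fobj (mfun M) x) x \<and>
     Comp C \<xi> (munit M x) = Id C x \<and>
     Comp C \<xi> (mmult M x) = Comp C \<xi> (farr (mfun M) \<xi>)"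

definition EM :: "('o, 'm) cat \<Rightarrow> ('o, 'm) mnd \<Rightarrow> ('o \<times> 'm, ('o \<times> 'm) \<times> 'm \<times> ('o \<times> 'm)) cat" where
  "EM C M =
    \<lparr>Obj = {(x, \<xi>). EM_algebra C M x \<xi>},
     Arr = {((x, \<xi>), h, (y, \<theta>)). EM_algebra C M x \<xi> \<and> EM_algebra C M y \<theta> \<and> h \<in> hom C x y \<and>
        Comp C h \<xi> = Comp C \<theta> (farr (mfun M) h)},
     Dom = (\<lambda>(p, h, q). p), Cod = (\<lambda>(p, h, q). q),
     Id = (\<lambda>(x, \<xi>). ((x, \<xi>), Id C x, (x, \<xi>))),
     Comp = (\<lambda>(q, k, r) (p, h, q'). (p, Comp C k h, r))\<rparr>"

definition EM_forget ::
  "('o, 'm) cat \<Rightarrow> ('o, 'm) mnd \<Rightarrow> ('o \<times> 'm, ('o \<times> 'm) \<times> 'm \<times> ('o \<times> 'm), 'o, 'm) fnctr" where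
  "EM_forget C M =
    \<lparr>fobj = (\<lambda>(x, \<xi>)\<in>Obj (EM C M). x), farr = (\<lambda>(p, h, q)\<in>Arr (EM C M). h)\<rparr>"

text \<open>The category \<open>A \<ltimes>\<^sup>T X\<close>, its projection \<open>p\<^sup>T\<close> to \<open>A\<close>, and its projection to \<open>A \<times> X\<close>.\<close>

type_synonym ('a, 'f, 'x, 'm) ltimes_arr =
  "('a \<times> 'x \<times> 'm) \<times> ('f \<times> 'm) \<times> ('a \<times> 'x \<times> 'm)"

definition ltimes ::
  "('a, 'f) cat \<Rightarrow> ('x, 'm) cat \<Rightarrow> ('a, 'f, 'x, 'm) param_monad \<Rightarrow>
   ('a \<times> 'x \<times> 'm, ('a, 'f, 'x, 'm) ltimes_arr) cat" where
  "ltimes A X T =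
    \<lparr>Obj = {(a, x, \<xi>). a \<in> Obj A \<and> EM_algebra X (fobj T a) x \<xi>},
     Arr = {((a, x, \<xi>), (f, g), (b, y, \<theta>)).
        a \<in> Obj A \<and> EM_algebra X (fobj T a) x \<xi> \<and>
        b \<in> Obj A \<and> EM_algebra X (fobj T b) y \<theta> \<and>
        f \<in> hom A a b \<and> g \<in> hom X x y \<and>
        Comp X g \<xi> = Comp X \<theta> (pm_map A X T f g)},
     Dom = (\<lambda>(p, h, q). p), Cod = (\<lambda>(p, h, q). q),
     Id = (\<lambda>(a, x, \<xi>). ((a, x, \<xi>), (Id A a, Id X x), (a, x, \<xi>))),
     Comp = (\<lambda>(q, (f', g'), r) (p, (f, g), q'). (p, (Comp A f' f, Comp X g' g), r))\<rparr>"

definition ltimes_proj ::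
  "('a, 'f) cat \<Rightarrow> ('x, 'm) cat \<Rightarrow> ('a, 'f, 'x, 'm) param_monad \<Rightarrow>
   ('a \<times> 'x \<times> 'm, ('a, 'f, 'x, 'm) ltimes_arr, 'a, 'f) fnctr" where
  "ltimes_proj A X T =
    \<lparr>fobj = (\<lambda>(a, x, \<xi>)\<in>Obj (ltimes A X T). a),
     farr = (\<lambda>(p, (f, g), q)\<in>Arr (ltimes A X T). f)\<rparr>"

definition ltimes_forget ::
  "('a, 'f) cat \<Rightarrow> ('x, 'm) cat \<Rightarrow> ('a, 'f, 'x, 'm) param_monad \<Rightarrow>
   ('a \<times> 'x \<times> 'm, ('a, 'f, 'x, 'm) ltimes_arr, 'a \<times> 'x, 'f \<times> 'm) fnctr" where
  "ltimes_forget A X T =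
    \<lparr>fobj = (\<lambda>(a, x, \<xi>)\<in>Obj (ltimes A X T). (a, x)),
     farr = (\<lambda>(p, h, q)\<in>Arr (ltimes A X T). h)\<rparr>"

text \<open>The tautological action of \<open>That\<close> on \<^const>\<open>ltimes_forget\<close>.\<close>

definition ltimes_action ::
  "('a, 'f) cat \<Rightarrow> ('x, 'm) cat \<Rightarrow> ('a, 'f, 'x, 'm) param_monad \<Rightarrow> 'a \<times> 'x \<times> 'm \<Rightarrow> 'f \<times> 'm" where
  "ltimes_action A X T = (\<lambda>(a, x, \<xi>)\<in>Obj (ltimes A X T). (Id A a, \<xi>))"


section \<open>The slice 2-category over a category\<close>

text \<open>An object is a pair \<open>(C, p)\<close> with \<open>p : C \<rightarrow> A\<close>. A 1-cell \<open>(C, p) \<rightarrow> (D, q)\<close> is a pair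
  \<open>(F, \<phi>)\<close> of a functor \<open>F : C \<rightarrow> D\<close> and a natural isomorphism \<open>\<phi> : q F \<Rightarrow> p\<close>. Both versions of
  the slice are covered: in the \<open>Strict\<close> one the triangles commute on the nose and \<open>\<phi>\<close> is the
  identity, in the \<open>Pseudo\<close> one \<open>\<phi>\<close> is an arbitrary specified isomorphism. A 2-cell
  \<open>(F, \<phi>) \<Rightarrow> (G, \<psi>)\<close> is an \<open>\<alpha> : F \<Rightarrow> G\<close> with \<open>\<psi> \<cdot> q\<alpha> = \<phi>\<close>; in the strict case this says that
  \<open>q\<alpha>\<close> is the identity.\<close>

datatype slice_kind = Strict | Pseudo

type_synonym ('o, 'm, 'a, 'f) slice_obj = "('o, 'm) cat \<times> ('o, 'm, 'a, 'f) fnctr"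
type_synonym ('o, 'm, 'p, 'n, 'f) slice_cell = "('o, 'm, 'p, 'n) fnctr \<times> ('o \<Rightarrow> 'f)"

definition is_slice_obj :: "('a, 'f) cat \<Rightarrow> ('o, 'm, 'a, 'f) slice_obj \<Rightarrow> bool" where
  "is_slice_obj A c \<longleftrightarrow> is_functor (fst c) A (snd c)"

definition slice_1cell ::
  "slice_kind \<Rightarrow> ('a, 'f) cat \<Rightarrow> ('o, 'm, 'a, 'f) slice_obj \<Rightarrow> ('p, 'n, 'a, 'f) slice_obj \<Rightarrow>
   ('o, 'm, 'p, 'n, 'f) slice_cell \<Rightarrow> bool" where
  "slice_1cell s A c d F \<longleftrightarrow> is_slice_obj A c \<and> is_slice_obj A d \<and>
     is_functor (fst c) (fst d) (fst F) \<and>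
     nat_iso (fst c) A (functor_comp (fst c) (snd d) (fst F)) (snd c) (snd F) \<and>
     (s = Strict \<longrightarrow>
        functor_comp (fst c) (snd d) (fst F) = snd c \<and> snd F = nat_id (fst c) A (snd c))"

definition slice_2cell ::
  "slice_kind \<Rightarrow> ('a, 'f) cat \<Rightarrow> ('o, 'm, 'a, 'f) slice_obj \<Rightarrow> ('p, 'n, 'a, 'f) slice_obj \<Rightarrow>
   ('o, 'm, 'p, 'n, 'f) slice_cell \<Rightarrow> ('o, 'm, 'p, 'n, 'f) slice_cell \<Rightarrow> ('o \<Rightarrow> 'n) \<Rightarrow> bool" where
  "slice_2cell s A c d F G \<alpha> \<longleftrightarrow> slice_1cell s A c d F \<and> slice_1cell s A c d G \<and>
     nat_trans (fst c) (fst d) (fst F) (fst G) \<alpha> \<and>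
     vcomp (fst c) A (snd G) (lwhisk (fst c) (snd d) \<alpha>) = snd F"

definition slice_id ::
  "('a, 'f) cat \<Rightarrow> ('o, 'm, 'a, 'f) slice_obj \<Rightarrow> ('o, 'm, 'o, 'm, 'f) slice_cell" where
  "slice_id A c = (functor_id (fst c), nat_id (fst c) A (snd c))"

text \<open>\<open>slice_comp A c G F\<close> is \<open>G \<circ> F\<close> for \<open>F\<close> with source \<open>c\<close>.\<close>

definition slice_comp ::
  "('a, 'f) cat \<Rightarrow> ('o, 'm, 'a, 'f) slice_obj \<Rightarrow> ('p, 'n, 'q, 'r, 'f) slice_cell \<Rightarrow>
   ('o, 'm, 'p, 'n, 'f) slice_cell \<Rightarrow> ('o, 'm, 'q, 'r, 'f) slice_cell" where
  "slice_comp A c G F =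
     (functor_comp (fst c) (fst G) (fst F), vcomp (fst c) A (snd F) (rwhisk (fst c) (snd G) (fst F)))"

type_synonym ('o, 'm, 'p, 'n, 'f) slice_hom_arr =
  "('o, 'm, 'p, 'n, 'f) slice_cell \<times> ('o \<Rightarrow> 'n) \<times> ('o, 'm, 'p, 'n, 'f) slice_cell"

definition slice_hom ::
  "slice_kind \<Rightarrow> ('a, 'f) cat \<Rightarrow> ('o, 'm, 'a, 'f) slice_obj \<Rightarrow> ('p, 'n, 'a, 'f) slice_obj \<Rightarrow>
   (('o, 'm, 'p, 'n, 'f) slice_cell, ('o, 'm, 'p, 'n, 'f) slice_hom_arr) cat" where
  "slice_hom s A c d =
    \<lparr>Obj = {F. slice_1cell s A c d F}, Arr = {(F, \<alpha>, G). slice_2cell s A c d F G \<alpha>},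
     Dom = (\<lambda>(F, \<alpha>, G). F), Cod = (\<lambda>(F, \<alpha>, G). G),
     Id = (\<lambda>F. (F, nat_id (fst c) (fst d) (fst F), F)),
     Comp = (\<lambda>(G, \<beta>, H) (F, \<alpha>, G'). (F, vcomp (fst c) (fst d) \<beta> \<alpha>, H))\<rparr>"

definition slice_equivalent ::
  "slice_kind \<Rightarrow> ('a, 'f) cat \<Rightarrow> ('o, 'm, 'a, 'f) slice_obj \<Rightarrow> ('p, 'n, 'a, 'f) slice_obj \<Rightarrow> bool"
  where
  "slice_equivalent s A c d \<longleftrightarrow>
     (\<exists>F G. slice_1cell s A c d F \<and> slice_1cell s A d c G \<and>
        isomorphic (slice_hom s A c c) (slice_comp A c G F) (slice_id A c) \<and>
        isomorphic (slice_hom s A d d) (slice_comp A d F G) (slice_id A d))"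


section \<open>Monads and Eilenberg--Moore objects in the slice 2-category\<close>

definition slice_monad ::
  "slice_kind \<Rightarrow> ('a, 'f) cat \<Rightarrow> ('o, 'm, 'a, 'f) slice_obj \<Rightarrow>
   ('o, 'm, 'o, 'm, 'f) slice_cell \<Rightarrow> ('o \<Rightarrow> 'm) \<Rightarrow> ('o \<Rightarrow> 'm) \<Rightarrow> bool" where
  "slice_monad s A c t \<eta> \<mu> \<longleftrightarrow>
     (let C = fst c; T = fst t in
      slice_1cell s A c c t \<and>
      slice_2cell s A c c (slice_id A c) t \<eta> \<and>
      slice_2cell s A c c (slice_comp A c t t) t \<mu> \<and>
      vcomp C C \<mu> (rwhisk C \<eta> T) = nat_id C C T \<and>
      vcomp C C \<mu> (lwhisk C T \<eta>) = nat_id C C T \<and>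
      vcomp C C \<mu> (rwhisk C \<mu> T) = vcomp C C \<mu> (lwhisk C T \<mu>))"

definition slice_module ::
  "slice_kind \<Rightarrow> ('a, 'f) cat \<Rightarrow> ('g, 'h, 'a, 'f) slice_obj \<Rightarrow> ('o, 'm, 'a, 'f) slice_obj \<Rightarrow>
   ('o, 'm, 'o, 'm, 'f) slice_cell \<Rightarrow> ('o \<Rightarrow> 'm) \<Rightarrow> ('o \<Rightarrow> 'm) \<Rightarrow>
   ('g, 'h, 'o, 'm, 'f) slice_cell \<Rightarrow> ('g \<Rightarrow> 'm) \<Rightarrow> bool" where
  "slice_module s A g c t \<eta> \<mu> m l \<longleftrightarrow>
     (let G = fst g; C = fst c in
      slice_1cell s A g c m \<and>
      slice_2cell s A g c (slice_comp A g t m) m l \<and>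
      vcomp G C l (rwhisk G \<eta> (fst m)) = nat_id G C (fst m) \<and>
      vcomp G C l (rwhisk G \<mu> (fst m)) = vcomp G C l (lwhisk G (fst t) l))"

type_synonym ('g, 'h, 'o, 'm, 'f) slice_mod = "('g, 'h, 'o, 'm, 'f) slice_cell \<times> ('g \<Rightarrow> 'm)"
type_synonym ('g, 'h, 'o, 'm, 'f) slice_mod_arr =
  "('g, 'h, 'o, 'm, 'f) slice_mod \<times> ('g \<Rightarrow> 'm) \<times> ('g, 'h, 'o, 'm, 'f) slice_mod"

definition slice_Mod ::
  "slice_kind \<Rightarrow> ('a, 'f) cat \<Rightarrow> ('g, 'h, 'a, 'f) slice_obj \<Rightarrow> ('o, 'm, 'a, 'f) slice_obj \<Rightarrow>
   ('o, 'm, 'o, 'm, 'f) slice_cell \<Rightarrow> ('o \<Rightarrow> 'm) \<Rightarrow> ('o \<Rightarrow> 'm) \<Rightarrow>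
   (('g, 'h, 'o, 'm, 'f) slice_mod, ('g, 'h, 'o, 'm, 'f) slice_mod_arr) cat" where
  "slice_Mod s A g c t \<eta> \<mu> =
    \<lparr>Obj = {(m, l). slice_module s A g c t \<eta> \<mu> m l},
     Arr = {((m, l), \<sigma>, (m', l')).
        slice_module s A g c t \<eta> \<mu> m l \<and> slice_module s A g c t \<eta> \<mu> m' l' \<and>
        slice_2cell s A g c m m' \<sigma> \<and>
        vcomp (fst g) (fst c) \<sigma> l = vcomp (fst g) (fst c) l' (lwhisk (fst g) (fst t) \<sigma>)},
     Dom = (\<lambda>(p, \<sigma>, q). p), Cod = (\<lambda>(p, \<sigma>, q). q),
     Id = (\<lambda>(m, l). ((m, l), nat_id (fst g) (fst c) (fst m), (m, l))),
     Comp = (\<lambda>(q, \<tau>, r) (p, \<sigma>, q'). (p, vcomp (fst g) (fst c) \<tau> \<sigma>, r))\<rparr>"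

text \<open>The 2-functors \<open>g \<mapsto> Hom(g, e)\<close> and \<open>g \<mapsto> Mod(g, t)\<close> act on a 1-cell \<open>h : g' \<rightarrow> g\<close> by the
  functors \<open>hom_pre\<close> and \<open>mod_pre\<close> (precomposition with \<open>h\<close>), and on a 2-cell \<open>\<rho> : h \<Rightarrow> h'\<close> by
  the natural transformations \<open>hom_pre2\<close> and \<open>mod_pre2\<close>, with components \<open>k\<rho>\<close> and \<open>m\<rho>\<close>.\<close>

definition hom_pre ::
  "slice_kind \<Rightarrow> ('a, 'f) cat \<Rightarrow> ('k, 'l, 'a, 'f) slice_obj \<Rightarrow> ('g, 'h, 'a, 'f) slice_obj \<Rightarrow>
   ('e, 'i, 'a, 'f) slice_obj \<Rightarrow> ('k, 'l, 'g, 'h, 'f) slice_cell \<Rightarrow>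
   (('g, 'h, 'e, 'i, 'f) slice_cell, ('g, 'h, 'e, 'i, 'f) slice_hom_arr,
    ('k, 'l, 'e, 'i, 'f) slice_cell, ('k, 'l, 'e, 'i, 'f) slice_hom_arr) fnctr" where
  "hom_pre s A g' g e h =
    \<lparr>fobj = (\<lambda>k\<in>Obj (slice_hom s A g e). slice_comp A g' k h),
     farr = (\<lambda>(k, \<sigma>, k')\<in>Arr (slice_hom s A g e).
        (slice_comp A g' k h, rwhisk (fst g') \<sigma> (fst h), slice_comp A g' k' h))\<rparr>"

definition hom_pre2 ::
  "slice_kind \<Rightarrow> ('a, 'f) cat \<Rightarrow> ('k, 'l, 'a, 'f) slice_obj \<Rightarrow> ('g, 'h, 'a, 'f) slice_obj \<Rightarrow>
   ('e, 'i, 'a, 'f) slice_obj \<Rightarrow>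
   ('k, 'l, 'g, 'h, 'f) slice_cell \<Rightarrow> ('k, 'l, 'g, 'h, 'f) slice_cell \<Rightarrow> ('k \<Rightarrow> 'h) \<Rightarrow>
   ('g, 'h, 'e, 'i, 'f) slice_cell \<Rightarrow> ('k, 'l, 'e, 'i, 'f) slice_hom_arr" where
  "hom_pre2 s A g' g e h h' \<rho> =
     (\<lambda>k\<in>Obj (slice_hom s A g e).
        (slice_comp A g' k h, lwhisk (fst g') (fst k) \<rho>, slice_comp A g' k h'))"

definition mod_pre_obj ::
  "('a, 'f) cat \<Rightarrow> ('k, 'l, 'a, 'f) slice_obj \<Rightarrow> ('k, 'l, 'g, 'h, 'f) slice_cell \<Rightarrow>
   ('g, 'h, 'o, 'm, 'f) slice_mod \<Rightarrow> ('k, 'l, 'o, 'm, 'f) slice_mod" where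
  "mod_pre_obj A g' h = (\<lambda>(m, l). (slice_comp A g' m h, rwhisk (fst g') l (fst h)))"

definition mod_pre ::
  "slice_kind \<Rightarrow> ('a, 'f) cat \<Rightarrow> ('k, 'l, 'a, 'f) slice_obj \<Rightarrow> ('g, 'h, 'a, 'f) slice_obj \<Rightarrow>
   ('o, 'm, 'a, 'f) slice_obj \<Rightarrow> ('o, 'm, 'o, 'm, 'f) slice_cell \<Rightarrow>
   ('o \<Rightarrow> 'm) \<Rightarrow> ('o \<Rightarrow> 'm) \<Rightarrow> ('k, 'l, 'g, 'h, 'f) slice_cell \<Rightarrow>
   (('g, 'h, 'o, 'm, 'f) slice_mod, ('g, 'h, 'o, 'm, 'f) slice_mod_arr,
    ('k, 'l, 'o, 'm, 'f) slice_mod, ('k, 'l, 'o, 'm, 'f) slice_mod_arr) fnctr" where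
  "mod_pre s A g' g c t \<eta> \<mu> h =
    \<lparr>fobj = (\<lambda>n\<in>Obj (slice_Mod s A g c t \<eta> \<mu>). mod_pre_obj A g' h n),
     farr = (\<lambda>(n, \<sigma>, n')\<in>Arr (slice_Mod s A g c t \<eta> \<mu>).
        (mod_pre_obj A g' h n, rwhisk (fst g') \<sigma> (fst h), mod_pre_obj A g' h n'))\<rparr>"

definition mod_pre2 ::
  "slice_kind \<Rightarrow> ('a, 'f) cat \<Rightarrow> ('k, 'l, 'a, 'f) slice_obj \<Rightarrow> ('g, 'h, 'a, 'f) slice_obj \<Rightarrow>
   ('o, 'm, 'a, 'f) slice_obj \<Rightarrow> ('o, 'm, 'o, 'm, 'f) slice_cell \<Rightarrow>
   ('o \<Rightarrow> 'm) \<Rightarrow> ('o \<Rightarrow> 'm) \<Rightarrow>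
   ('k, 'l, 'g, 'h, 'f) slice_cell \<Rightarrow> ('k, 'l, 'g, 'h, 'f) slice_cell \<Rightarrow> ('k \<Rightarrow> 'h) \<Rightarrow>
   ('g, 'h, 'o, 'm, 'f) slice_mod \<Rightarrow> ('k, 'l, 'o, 'm, 'f) slice_mod_arr" where
  "mod_pre2 s A g' g c t \<eta> \<mu> h h' \<rho> =
     (\<lambda>(m, l)\<in>Obj (slice_Mod s A g c t \<eta> \<mu>).
        (mod_pre_obj A g' h (m, l), lwhisk (fst g') (fst m) \<rho>, mod_pre_obj A g' h' (m, l)))"

text \<open>The functor \<open>Hom(g, e) \<rightarrow> Mod(g, t)\<close>, \<open>k \<mapsto> (u k, l k)\<close>, induced by a module \<open>(u, l)\<close>
  with source \<open>e\<close>.\<close>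

definition EM_comparison ::
  "slice_kind \<Rightarrow> ('a, 'f) cat \<Rightarrow> ('g, 'h, 'a, 'f) slice_obj \<Rightarrow> ('e, 'i, 'a, 'f) slice_obj \<Rightarrow>
   ('e, 'i, 'o, 'm, 'f) slice_cell \<Rightarrow> ('e \<Rightarrow> 'm) \<Rightarrow>
   (('g, 'h, 'e, 'i, 'f) slice_cell, ('g, 'h, 'e, 'i, 'f) slice_hom_arr,
    ('g, 'h, 'o, 'm, 'f) slice_mod, ('g, 'h, 'o, 'm, 'f) slice_mod_arr) fnctr" where
  "EM_comparison s A g e u l =
    \<lparr>fobj = (\<lambda>k\<in>Obj (slice_hom s A g e). mod_pre_obj A g k (u, l)),
     farr = (\<lambda>(k, \<sigma>, k')\<in>Arr (slice_hom s A g e).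
        (mod_pre_obj A g k (u, l), lwhisk (fst g) (fst u) \<sigma>, mod_pre_obj A g k' (u, l)))\<rparr>"

text \<open>\<open>e\<close> is the Eilenberg--Moore object of the monad \<open>(t, \<eta>, \<mu>)\<close> on \<open>c\<close>, with universal module
  \<open>(u, l)\<close>: the comparison functors are isomorphisms of categories \<open>Hom(g, e) \<cong> Mod(g, t)\<close>,
  2-natural in \<open>g\<close>. The categories underlying the test objects \<open>g\<close> and \<open>g'\<close> range over all
  categories with objects and arrows in \<open>'g\<close>, \<open>'h\<close> and in \<open>'k\<close>, \<open>'l\<close> respectively. HOL cannot
  quantify over types inside a formula, so these types are parameters, to be left arbitrary; for
  the same reason \<open>(u, l)\<close>, which must not depend on them, is an argument and not existentially
  quantified.\<close>

definition is_EM_object ::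
  "('g \<times> 'h) itself \<Rightarrow> ('k \<times> 'l) itself \<Rightarrow> slice_kind \<Rightarrow> ('a, 'f) cat \<Rightarrow>
   ('o, 'm, 'a, 'f) slice_obj \<Rightarrow>
   ('o, 'm, 'o, 'm, 'f) slice_cell \<Rightarrow> ('o \<Rightarrow> 'm) \<Rightarrow> ('o \<Rightarrow> 'm) \<Rightarrow>
   ('e, 'i, 'a, 'f) slice_obj \<Rightarrow> ('e, 'i, 'o, 'm, 'f) slice_cell \<Rightarrow> ('e \<Rightarrow> 'm) \<Rightarrow> bool" where
  "is_EM_object _ _ s A c t \<eta> \<mu> e u l \<longleftrightarrow>
     slice_monad s A c t \<eta> \<mu> \<and> is_slice_obj A e \<and> slice_module s A e c t \<eta> \<mu> u l \<and>
     (\<forall>g :: ('g, 'h, 'a, 'f) slice_obj. is_slice_obj A g \<longrightarrow>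
        cat_isomorphism (slice_hom s A g e) (slice_Mod s A g c t \<eta> \<mu>) (EM_comparison s A g e u l)) \<and>
     (\<forall>(g :: ('g, 'h, 'a, 'f) slice_obj) (g' :: ('k, 'l, 'a, 'f) slice_obj) h.
        slice_1cell s A g' g h \<longrightarrow>
        functor_comp (slice_hom s A g e) (EM_comparison s A g' e u l) (hom_pre s A g' g e h) =
        functor_comp (slice_hom s A g e) (mod_pre s A g' g c t \<eta> \<mu> h) (EM_comparison s A g e u l)) \<and>
     (\<forall>(g :: ('g, 'h, 'a, 'f) slice_obj) (g' :: ('k, 'l, 'a, 'f) slice_obj) h h' \<rho>.
        slice_2cell s A g' g h h' \<rho> \<longrightarrow>
        lwhisk (slice_hom s A g e) (EM_comparison s A g' e u l) (hom_pre2 s A g' g e h h' \<rho>) =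
        rwhisk (slice_hom s A g e) (mod_pre2 s A g' g c t \<eta> \<mu> h h' \<rho>) (EM_comparison s A g e u l))"

end

theory Submission
  imports Defs
begin

text \<open>
  Objects of \<open>A \<ltimes>\<^sup>T X\<close> and algebras for \<open>That\<close> are the same data. The unit of \<open>That\<close> at \<open>(a, x)\<close> is
  \<open>(id, \<eta>)\<close>, so the unit law makes the first component of a structure map \<open>(i, \<xi>)\<close> an identity, and
  what remains is an algebra \<open>\<xi>\<close> for the monad at \<open>a\<close>; a morphism of such algebras is a pair
  \<open>(f, g)\<close> satisfying the equation that defines an arrow of \<open>A \<ltimes>\<^sup>T X\<close>. This gives an isomorphism of
  categories that commutes with the projections to \<open>A\<close>, which is more than the asserted equivalence
  (\<open>EM_algebra_That_iff\<close>, \<open>cat_isomorphism_to_EM\<close>, \<open>ltimes_equivalent_EM\<close>).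

  That \<open>That\<close> is a functor with natural unit and multiplication expresses the naturality of
  \<open>T\<^sub>f\<close> in its argument, the functoriality of \<open>f \<mapsto> T\<^sub>f\<close>, and the compatibility of \<open>T\<^sub>f\<close> with units and
  multiplications (\<open>pm_map_Comp\<close>, \<open>pm_map_unit\<close>, \<open>pm_map_mult\<close>). All its structure lies over
  identities of \<open>A\<close>, so it is a monad in the slice.

  For the universal property, a module \<open>(M, \<phi>, l)\<close> over \<open>That\<close> with source \<open>g\<close> assigns to an object
  \<open>x\<close> of \<open>g\<close> an object \<open>(a, y)\<close> of \<open>A \<times> X\<close> and an action \<open>l x\<close>. The action is a 2-cell of the slice, so
  \<open>\<phi>\<^sub>x \<circ> fst (l x) = \<phi>\<^sub>x\<close>, and since \<open>\<phi>\<^sub>x\<close> is invertible \<open>l x\<close> lies over an identity. This holds also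
  when the triangles only commute up to isomorphism, and it is the reason why both slices have the
  same Eilenberg--Moore object. Hence \<open>x \<mapsto> (a, y, snd (l x))\<close> is an object of \<open>A \<ltimes>\<^sup>T X\<close>, and
  naturality of \<open>l\<close> makes this a functor, the unique one that induces the module
  (\<open>module_at\<close>, \<open>lift_1cell\<close>, \<open>comparison_inj_on_1cells\<close>). Module morphisms lift in the same way
  (\<open>lift_2cell\<close>), so the comparison functors are bijective on arrows, which suffices for an
  isomorphism of categories. Their 2-naturality is formal: it holds for the comparison induced by any
  module.
\<close>

section \<open>Calculus of arrows, functors and natural transformations\<close>

lemma homI: "f \<in> Arr C \<Longrightarrow> Dom C f = a \<Longrightarrow> Cod C f = b \<Longrightarrow> f \<in> hom C a b"
  by (simp add: hom_def)

lemma homD: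
  assumes "f \<in> hom C a b"
  shows "f \<in> Arr C" "Dom C f = a" "Cod C f = b"
  using assms by (auto simp: hom_def)

lemma arr_in_hom: "f \<in> Arr C \<Longrightarrow> f \<in> hom C (Dom C f) (Cod C f)"
  by (simp add: hom_def)

lemma hom_ObjD:
  assumes "category C" "f \<in> hom C a b"
  shows "a \<in> Obj C" "b \<in> Obj C"
  using assms by (auto simp: hom_def category_def)

lemma Id_in_hom: "category C \<Longrightarrow> a \<in> Obj C \<Longrightarrow> Id C a \<in> hom C a a"
  by (simp add: category_def)

lemma Comp_in_hom:
  "category C \<Longrightarrow> f \<in> hom C a b \<Longrightarrow> g \<in> hom C b c \<Longrightarrow> Comp C g f \<in> hom C a c"
  unfolding category_def hom_def by auto

lemma Comp_Id_right: "category C \<Longrightarrow> f \<in> hom C a b \<Longrightarrow> Comp C f (Id C a) = f"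
  unfolding category_def hom_def by auto

lemma Comp_Id_left: "category C \<Longrightarrow> f \<in> hom C a b \<Longrightarrow> Comp C (Id C b) f = f"
  unfolding category_def hom_def by auto

lemma Comp_assoc:
  "category C \<Longrightarrow> f \<in> hom C a b \<Longrightarrow> g \<in> hom C b c \<Longrightarrow> h \<in> hom C c d \<Longrightarrow>
     Comp C h (Comp C g f) = Comp C (Comp C h g) f"
  unfolding category_def hom_def by auto

lemma categoryI:
  assumes "\<And>f. f \<in> Arr C \<Longrightarrow> Dom C f \<in> Obj C" "\<And>f. f \<in> Arr C \<Longrightarrow> Cod C f \<in> Obj C"
    and "\<And>a. a \<in> Obj C \<Longrightarrow> Id C a \<in> hom C a a"
    and "\<And>f g. f \<in> Arr C \<Longrightarrow> g \<in> Arr C \<Longrightarrow> Dom C g = Cod C f \<Longrightarrow>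
           Comp C g f \<in> hom C (Dom C f) (Cod C g)"
    and "\<And>f. f \<in> Arr C \<Longrightarrow> Comp C f (Id C (Dom C f)) = f"
    and "\<And>f. f \<in> Arr C \<Longrightarrow> Comp C (Id C (Cod C f)) f = f"
    and "\<And>f g h. f \<in> Arr C \<Longrightarrow> g \<in> Arr C \<Longrightarrow> h \<in> Arr C \<Longrightarrow> Dom C g = Cod C f \<Longrightarrow>
           Dom C h = Cod C g \<Longrightarrow> Comp C h (Comp C g f) = Comp C (Comp C h g) f"
  shows "category C"
  using assms unfolding category_def by blast

lemma functor_categoryD:
  assumes "is_functor C D F"
  shows "category C" "category D"
  using assms by (auto simp: is_functor_def)

lemma functor_Obj: "is_functor C D F \<Longrightarrow> a \<in> Obj C \<Longrightarrow> fobj F a \<in> Obj D"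
  by (auto simp: is_functor_def)

lemma functor_Arr: "is_functor C D F \<Longrightarrow> f \<in> Arr C \<Longrightarrow> farr F f \<in> Arr D"
  by (auto simp: is_functor_def)

lemma functor_hom: "is_functor C D F \<Longrightarrow> f \<in> hom C a b \<Longrightarrow> farr F f \<in> hom D (fobj F a) (fobj F b)"
  by (auto simp: is_functor_def hom_def)

lemma functor_Id: "is_functor C D F \<Longrightarrow> a \<in> Obj C \<Longrightarrow> farr F (Id C a) = Id D (fobj F a)"
  by (auto simp: is_functor_def)

lemma functor_Comp:
  "is_functor C D F \<Longrightarrow> f \<in> hom C a b \<Longrightarrow> g \<in> hom C b c \<Longrightarrow>
     farr F (Comp C g f) = Comp D (farr F g) (farr F f)"
  by (auto simp: is_functor_def hom_def)

lemma is_functorI: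
  assumes "category C" "category D"
    and "fobj F \<in> extensional (Obj C)" "farr F \<in> extensional (Arr C)"
    and "\<And>a. a \<in> Obj C \<Longrightarrow> fobj F a \<in> Obj D"
    and "\<And>f a b. f \<in> hom C a b \<Longrightarrow> farr F f \<in> hom D (fobj F a) (fobj F b)"
    and "\<And>a. a \<in> Obj C \<Longrightarrow> farr F (Id C a) = Id D (fobj F a)"
    and "\<And>f g a b c. f \<in> hom C a b \<Longrightarrow> g \<in> hom C b c \<Longrightarrow>
           farr F (Comp C g f) = Comp D (farr F g) (farr F f)"
  shows "is_functor C D F"
proof -
  have 1: "farr F f \<in> hom D (fobj F (Dom C f)) (fobj F (Cod C f))" if "f \<in> Arr C" for f
    using assms(6) that by (auto simp: hom_def)
  then have "farr F f \<in> Arr D" if "f \<in> Arr C" for f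
    using that by (auto simp: hom_def)
  with 1 assms show ?thesis
    unfolding is_functor_def PiE_iff by (auto simp: hom_def)
qed

lemma functor_eqI:
  fixes F G :: "('o, 'm, 'p, 'n) fnctr"
  assumes "is_functor C D F" "is_functor C D G"
    and "\<And>a. a \<in> Obj C \<Longrightarrow> fobj F a = fobj G a"
    and "\<And>f. f \<in> Arr C \<Longrightarrow> farr F f = farr G f"
  shows "F = G"
proof -
  have "fobj F = fobj G" "farr F = farr G"
    using assms by (auto simp: is_functor_def intro: PiE_ext)
  then show ?thesis by simp
qed

lemma functor_comp_simps [simp]:
  "a \<in> Obj C \<Longrightarrow> fobj (functor_comp C G F) a = fobj G (fobj F a)"
  "f \<in> Arr C \<Longrightarrow> farr (functor_comp C G F) f = farr G (farr F f)"
  "a \<in> Obj C \<Longrightarrow> fobj (functor_id C) a = a"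
  "f \<in> Arr C \<Longrightarrow> farr (functor_id C) f = f"
  by (simp_all add: functor_comp_def functor_id_def)

lemma functor_comp_extensional [simp]:
  "fobj (functor_comp C G F) \<in> extensional (Obj C)"
  "farr (functor_comp C G F) \<in> extensional (Arr C)"
  by (simp_all add: functor_comp_def)

lemma is_functor_id: "category C \<Longrightarrow> is_functor C C (functor_id C)"
  by (rule is_functorI) (auto simp: functor_id_def Id_in_hom homD(1)[OF Id_in_hom] homD(1)
      homD(1)[OF Comp_in_hom] hom_ObjD)

lemma is_functor_comp:
  assumes F: "is_functor B C F" and G: "is_functor C D G"
  shows "is_functor B D (functor_comp B G F)"
proof (rule is_functorI)
  show "category B" "category D" using F G functor_categoryD by blast+
  show "fobj (functor_comp B G F) a \<in> Obj D" if "a \<in> Obj B" for a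
    using that F G by (simp add: functor_Obj)
  show "farr (functor_comp B G F) f \<in> hom D (fobj (functor_comp B G F) a) (fobj (functor_comp B G F) b)"
    if f: "f \<in> hom B a b" for f a b
    using functor_hom[OF G functor_hom[OF F f]] homD(1)[OF f] hom_ObjD[OF functor_categoryD(1)[OF F] f]
    by simp
  show "farr (functor_comp B G F) (Id B a) = Id D (fobj (functor_comp B G F) a)"
    if a: "a \<in> Obj B" for a
    using homD(1)[OF Id_in_hom[OF functor_categoryD(1)[OF F] a]] a F G
    by (simp add: functor_Id functor_Obj)
  show "farr (functor_comp B G F) (Comp B g f) =
      Comp D (farr (functor_comp B G F) g) (farr (functor_comp B G F) f)"
    if f: "f \<in> hom B a b" and g: "g \<in> hom B b c" for f g a b c
    using homD(1)[OF f] homD(1)[OF g] homD(1)[OF Comp_in_hom[OF functor_categoryD(1)[OF F] f g]]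
    by (simp add: functor_Comp[OF F f g] functor_Comp[OF G functor_hom[OF F f] functor_hom[OF F g]])
qed simp_all

lemma functor_comp_assoc:
  assumes F: "is_functor B C F"
  shows "functor_comp B H (functor_comp B G F) = functor_comp B (functor_comp C H G) F"
  using functor_Obj[OF F] functor_Arr[OF F]
  by (simp add: functor_comp_def restrict_def fun_eq_iff)

lemma functor_comp_id_right:
  assumes F: "is_functor C D F"
  shows "functor_comp C F (functor_id C) = F"
  by (rule functor_eqI[OF is_functor_comp[OF is_functor_id F] F]) (simp_all add: functor_categoryD[OF F])

text \<open>Bijectivity on arrows already forces bijectivity on objects, because an object is recovered
  from its identity arrow; and the inverse of a bijective functor preserves identities and
  composites because these are reflected along an injection.\<close>

lemma cat_isomorphism_if_bij_on_arrows:
  assumes F: "is_functor C D F" and bij: "bij_betw (farr F) (Arr C) (Arr D)"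
  shows "cat_isomorphism C D F"
proof -
  note C = functor_categoryD(1)[OF F] and D = functor_categoryD(2)[OF F]
  have inj: "inj_on (farr F) (Arr C)" and surj: "farr F ` Arr C = Arr D"
    using bij by (auto simp: bij_betw_def)
  have injO: "inj_on (fobj F) (Obj C)"
  proof (rule inj_onI)
    fix a b assume ab: "a \<in> Obj C" "b \<in> Obj C" "fobj F a = fobj F b"
    then have "farr F (Id C a) = farr F (Id C b)" by (simp add: functor_Id[OF F])
    then have "Id C a = Id C b"
      using inj ab Id_in_hom[OF C] by (metis homD(1) inj_onD)
    then show "a = b" using ab Id_in_hom[OF C] homD(2) by metis
  qed
  have surjO: "fobj F ` Obj C = Obj D"
  proof (intro equalityI subsetI)
    fix d assume d: "d \<in> Obj D"
    then have "Id D d \<in> Arr D" using Id_in_hom[OF D] homD(1) by metis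
    then obtain f where f: "f \<in> Arr C" "farr F f = Id D d" using surj by (metis imageE)
    have "farr F f \<in> hom D (fobj F (Dom C f)) (fobj F (Cod C f))"
      by (rule functor_hom[OF F arr_in_hom[OF f(1)]])
    then have "d = fobj F (Dom C f)"
      using f(2) Id_in_hom[OF D d] by (auto simp: hom_def)
    moreover have "Dom C f \<in> Obj C" using hom_ObjD(1)[OF C arr_in_hom[OF f(1)]] .
    ultimately show "d \<in> fobj F ` Obj C" by blast
  qed (auto simp: functor_Obj[OF F])
  define G where "G = \<lparr>fobj = (\<lambda>d\<in>Obj D. inv_into (Obj C) (fobj F) d),
                       farr = (\<lambda>f\<in>Arr D. inv_into (Arr C) (farr F) f)\<rparr>"
  have GO: "fobj G d \<in> Obj C" "fobj F (fobj G d) = d" if "d \<in> Obj D" for d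
    using that surjO by (auto simp: G_def inv_into_into f_inv_into_f)
  have GA: "farr G f \<in> Arr C" "farr F (farr G f) = f" if "f \<in> Arr D" for f
    using that surj by (auto simp: G_def inv_into_into f_inv_into_f)
  have FO: "fobj G (fobj F a) = a" if "a \<in> Obj C" for a
    using that injO functor_Obj[OF F] by (simp add: G_def)
  have FA: "farr G (farr F f) = f" if "f \<in> Arr C" for f
    using that inj functor_Arr[OF F] by (simp add: G_def)
  have Ghom: "farr G f \<in> hom C (fobj G a) (fobj G b)" if f: "f \<in> hom D a b" for f a b
  proof -
    have A: "farr G f \<in> Arr C" using GA homD(1)[OF f] by blast
    have "farr F (farr G f) \<in> hom D (fobj F (Dom C (farr G f))) (fobj F (Cod C (farr G f)))"
      by (rule functor_hom[OF F arr_in_hom[OF A]])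
    then have "a = fobj F (Dom C (farr G f))" "b = fobj F (Cod C (farr G f))"
      using f GA by (auto simp: hom_def)
    then show ?thesis
      using A FO hom_ObjD[OF C arr_in_hom[OF A]] by (simp add: hom_def)
  qed
  have "is_functor D C G"
  proof (rule is_functorI)
    show "fobj G \<in> extensional (Obj D)" "farr G \<in> extensional (Arr D)"
      by (simp_all add: G_def)
    show "farr G (Id D d) = Id C (fobj G d)" if d: "d \<in> Obj D" for d
      using FA[of "Id C (fobj G d)"] GO[OF d] functor_Id[OF F GO(1)[OF d]]
        homD(1)[OF Id_in_hom[OF C GO(1)[OF d]]] by simp
    show "farr G (Comp D g f) = Comp C (farr G g) (farr G f)"
      if f: "f \<in> hom D a b" and g: "g \<in> hom D b c" for f g a b c
      using functor_Comp[OF F Ghom[OF f] Ghom[OF g]] GA(2)[OF homD(1)[OF f]] GA(2)[OF homD(1)[OF g]]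
        FA[OF homD(1)[OF Comp_in_hom[OF C Ghom[OF f] Ghom[OF g]]]] by simp
  qed (use C D GO Ghom in auto)
  moreover have "functor_comp C G F = functor_id C" "functor_comp D F G = functor_id D"
    using FO FA GO GA by (simp_all add: functor_comp_def functor_id_def cong: restrict_cong)
  ultimately show ?thesis using F unfolding cat_isomorphism_def by blast
qed

lemma nat_transI:
  assumes "is_functor C D F" "is_functor C D G" "\<alpha> \<in> extensional (Obj C)"
    and "\<And>a. a \<in> Obj C \<Longrightarrow> \<alpha> a \<in> hom D (fobj F a) (fobj G a)"
    and "\<And>f a b. f \<in> hom C a b \<Longrightarrow> Comp D (\<alpha> b) (farr F f) = Comp D (farr G f) (\<alpha> a)"
  shows "nat_trans C D F G \<alpha>"
  using assms by (auto simp: nat_trans_def hom_def)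

lemma nat_trans_functorD:
  assumes "nat_trans C D F G \<alpha>"
  shows "is_functor C D F" "is_functor C D G"
  using assms by (auto simp: nat_trans_def)

lemma nat_trans_extensional: "nat_trans C D F G \<alpha> \<Longrightarrow> \<alpha> \<in> extensional (Obj C)"
  by (simp add: nat_trans_def)

lemma nat_trans_hom: "nat_trans C D F G \<alpha> \<Longrightarrow> a \<in> Obj C \<Longrightarrow> \<alpha> a \<in> hom D (fobj F a) (fobj G a)"
  by (simp add: nat_trans_def)

lemma nat_trans_natural:
  "nat_trans C D F G \<alpha> \<Longrightarrow> f \<in> hom C a b \<Longrightarrow> Comp D (\<alpha> b) (farr F f) = Comp D (farr G f) (\<alpha> a)"
  by (auto simp: nat_trans_def hom_def)

lemma transformation_simps [simp]:
  "a \<in> Obj C \<Longrightarrow> nat_id C D F a = Id D (fobj F a)"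
  "a \<in> Obj C \<Longrightarrow> vcomp C D \<beta> \<alpha> a = Comp D (\<beta> a) (\<alpha> a)"
  "a \<in> Obj C \<Longrightarrow> lwhisk C H \<gamma> a = farr H (\<gamma> a)"
  "a \<in> Obj C \<Longrightarrow> rwhisk C \<delta> K a = \<delta> (fobj K a)"
  by (simp_all add: nat_id_def vcomp_def lwhisk_def rwhisk_def)

lemma transformation_extensional [simp]:
  "nat_id C D F \<in> extensional (Obj C)"
  "vcomp C D \<beta> \<alpha> \<in> extensional (Obj C)"
  "lwhisk C H \<gamma> \<in> extensional (Obj C)"
  "rwhisk C \<delta> K \<in> extensional (Obj C)"
  by (simp_all add: nat_id_def vcomp_def lwhisk_def rwhisk_def)

lemma nat_trans_nat_id:
  assumes F: "is_functor C D F"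
  shows "nat_trans C D F F (nat_id C D F)"
proof (rule nat_transI[OF F F])
  note D = functor_categoryD(2)[OF F]
  show "nat_id C D F a \<in> hom D (fobj F a) (fobj F a)" if "a \<in> Obj C" for a
    using that by (simp add: Id_in_hom[OF D] functor_Obj[OF F])
  show "Comp D (nat_id C D F b) (farr F f) = Comp D (farr F f) (nat_id C D F a)"
    if f: "f \<in> hom C a b" for f a b
    using hom_ObjD[OF functor_categoryD(1)[OF F] f] functor_hom[OF F f]
    by (simp add: Comp_Id_left[OF D] Comp_Id_right[OF D])
qed simp

lemma nat_trans_vcomp:
  assumes a: "nat_trans C D F G \<alpha>" and b: "nat_trans C D G H \<beta>"
  shows "nat_trans C D F H (vcomp C D \<beta> \<alpha>)"
proof (rule nat_transI[OF nat_trans_functorD(1)[OF a] nat_trans_functorD(2)[OF b]])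
  note F = nat_trans_functorD(1)[OF a] and G = nat_trans_functorD(2)[OF a]
    and H = nat_trans_functorD(2)[OF b]
  note C = functor_categoryD(1)[OF F] and D = functor_categoryD(2)[OF F]
  show "vcomp C D \<beta> \<alpha> x \<in> hom D (fobj F x) (fobj H x)" if "x \<in> Obj C" for x
    using that Comp_in_hom[OF D nat_trans_hom[OF a that] nat_trans_hom[OF b that]] by simp
  show "Comp D (vcomp C D \<beta> \<alpha> y) (farr F f) = Comp D (farr H f) (vcomp C D \<beta> \<alpha> x)"
    if f: "f \<in> hom C x y" for f x y
  proof -
    note x = hom_ObjD(1)[OF C f] and y = hom_ObjD(2)[OF C f]
    have "Comp D (Comp D (\<beta> y) (\<alpha> y)) (farr F f) = Comp D (\<beta> y) (Comp D (\<alpha> y) (farr F f))"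
      by (rule Comp_assoc[OF D functor_hom[OF F f] nat_trans_hom[OF a y] nat_trans_hom[OF b y], symmetric])
    also have "\<dots> = Comp D (\<beta> y) (Comp D (farr G f) (\<alpha> x))"
      by (simp add: nat_trans_natural[OF a f])
    also have "\<dots> = Comp D (Comp D (\<beta> y) (farr G f)) (\<alpha> x)"
      by (rule Comp_assoc[OF D nat_trans_hom[OF a x] functor_hom[OF G f] nat_trans_hom[OF b y]])
    also have "\<dots> = Comp D (Comp D (farr H f) (\<beta> x)) (\<alpha> x)"
      by (simp add: nat_trans_natural[OF b f])
    also have "\<dots> = Comp D (farr H f) (Comp D (\<beta> x) (\<alpha> x))"
      by (rule Comp_assoc[OF D nat_trans_hom[OF a x] nat_trans_hom[OF b x] functor_hom[OF H f], symmetric])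
    finally show ?thesis using x y by simp
  qed
qed simp

lemma nat_trans_lwhisk:
  assumes a: "nat_trans C D F G \<alpha>" and H: "is_functor D E H"
  shows "nat_trans C E (functor_comp C H F) (functor_comp C H G) (lwhisk C H \<alpha>)"
proof (rule nat_transI)
  note F = nat_trans_functorD(1)[OF a] and G = nat_trans_functorD(2)[OF a]
  note C = functor_categoryD(1)[OF F]
  show "is_functor C E (functor_comp C H F)" "is_functor C E (functor_comp C H G)"
    using is_functor_comp F G H by blast+
  show "lwhisk C H \<alpha> x \<in> hom E (fobj (functor_comp C H F) x) (fobj (functor_comp C H G) x)"
    if "x \<in> Obj C" for x
    using that functor_hom[OF H nat_trans_hom[OF a that]] by simp
  show "Comp E (lwhisk C H \<alpha> y) (farr (functor_comp C H F) f) =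
      Comp E (farr (functor_comp C H G) f) (lwhisk C H \<alpha> x)"
    if f: "f \<in> hom C x y" for f x y
  proof -
    note x = hom_ObjD(1)[OF C f] and y = hom_ObjD(2)[OF C f]
    show ?thesis
      using functor_Comp[OF H functor_hom[OF F f] nat_trans_hom[OF a y]]
        functor_Comp[OF H nat_trans_hom[OF a x] functor_hom[OF G f]]
        nat_trans_natural[OF a f] x y homD(1)[OF f] by simp
  qed
qed simp

lemma nat_trans_rwhisk:
  assumes K: "is_functor B C K" and a: "nat_trans C D F G \<alpha>"
  shows "nat_trans B D (functor_comp B F K) (functor_comp B G K) (rwhisk B \<alpha> K)"
proof (rule nat_transI)
  note F = nat_trans_functorD(1)[OF a] and G = nat_trans_functorD(2)[OF a]
  note B = functor_categoryD(1)[OF K]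
  show "is_functor B D (functor_comp B F K)" "is_functor B D (functor_comp B G K)"
    using is_functor_comp F G K by blast+
  show "rwhisk B \<alpha> K x \<in> hom D (fobj (functor_comp B F K) x) (fobj (functor_comp B G K) x)"
    if "x \<in> Obj B" for x
    using that nat_trans_hom[OF a functor_Obj[OF K that]] by simp
  show "Comp D (rwhisk B \<alpha> K y) (farr (functor_comp B F K) f) =
      Comp D (farr (functor_comp B G K) f) (rwhisk B \<alpha> K x)"
    if f: "f \<in> hom B x y" for f x y
    using nat_trans_natural[OF a functor_hom[OF K f]] hom_ObjD[OF B f] homD(1)[OF f] by simp
qed simp

lemma vcomp_assoc:
  assumes "nat_trans C D F G \<alpha>" "nat_trans C D G H \<beta>" "nat_trans C D H K \<gamma>"
  shows "vcomp C D \<gamma> (vcomp C D \<beta> \<alpha>) = vcomp C D (vcomp C D \<gamma> \<beta>) \<alpha>"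
proof (rule extensionalityI[where A="Obj C"])
  note D = functor_categoryD(2)[OF nat_trans_functorD(1)[OF assms(1)]]
  show "vcomp C D \<gamma> (vcomp C D \<beta> \<alpha>) a = vcomp C D (vcomp C D \<gamma> \<beta>) \<alpha> a" if "a \<in> Obj C" for a
    using that Comp_assoc[OF D nat_trans_hom[OF assms(1) that] nat_trans_hom[OF assms(2) that]
        nat_trans_hom[OF assms(3) that]] by simp
qed simp_all

lemma vcomp_nat_id_left:
  assumes a: "nat_trans C D F G \<alpha>"
  shows "vcomp C D (nat_id C D G) \<alpha> = \<alpha>"
proof (rule extensionalityI[where A="Obj C"])
  note D = functor_categoryD(2)[OF nat_trans_functorD(1)[OF a]]
  show "vcomp C D (nat_id C D G) \<alpha> x = \<alpha> x" if "x \<in> Obj C" for x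
    using that Comp_Id_left[OF D nat_trans_hom[OF a that]] by simp
qed (simp_all add: nat_trans_extensional[OF a])

lemma vcomp_nat_id_right:
  assumes a: "nat_trans C D F G \<alpha>"
  shows "vcomp C D \<alpha> (nat_id C D F) = \<alpha>"
proof (rule extensionalityI[where A="Obj C"])
  note D = functor_categoryD(2)[OF nat_trans_functorD(1)[OF a]]
  show "vcomp C D \<alpha> (nat_id C D F) x = \<alpha> x" if "x \<in> Obj C" for x
    using that Comp_Id_right[OF D nat_trans_hom[OF a that]] by simp
qed (simp_all add: nat_trans_extensional[OF a])

lemma lwhisk_nat_id:
  assumes F: "is_functor C D F" and H: "is_functor D E H"
  shows "lwhisk C H (nat_id C D F) = nat_id C E (functor_comp C H F)"
  by (rule extensionalityI[where A="Obj C"]) (simp_all add: functor_Id[OF H] functor_Obj[OF F])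

lemma rwhisk_nat_id:
  assumes K: "is_functor B C K"
  shows "rwhisk B (nat_id C D F) K = nat_id B D (functor_comp B F K)"
  by (rule extensionalityI[where A="Obj B"]) (simp_all add: functor_Obj[OF K])

lemma lwhisk_vcomp:
  assumes a: "nat_trans C D F G \<alpha>" and b: "nat_trans C D G K \<beta>" and H: "is_functor D E H"
  shows "lwhisk C H (vcomp C D \<beta> \<alpha>) = vcomp C E (lwhisk C H \<beta>) (lwhisk C H \<alpha>)"
  by (rule extensionalityI[where A="Obj C"])
    (simp_all add: functor_Comp[OF H nat_trans_hom[OF a] nat_trans_hom[OF b]])

lemma rwhisk_vcomp:
  assumes K: "is_functor B C K"
  shows "rwhisk B (vcomp C D \<beta> \<alpha>) K = vcomp B D (rwhisk B \<beta> K) (rwhisk B \<alpha> K)"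
  by (rule extensionalityI[where A="Obj B"]) (simp_all add: functor_Obj[OF K])

lemma iso_arrow_Id:
  assumes "category C" "a \<in> Obj C"
  shows "iso_arrow C (Id C a)"
  using Id_in_hom[OF assms] Comp_Id_left[OF assms(1) Id_in_hom[OF assms]]
  unfolding iso_arrow_def inverse_arrows_def by (auto simp: hom_def)

lemma iso_arrow_Comp:
  assumes C: "category C" and f: "f \<in> hom C a b" "iso_arrow C f" and g: "g \<in> hom C b c" "iso_arrow C g"
  shows "iso_arrow C (Comp C g f)"
proof -
  obtain f' g' where f': "f' \<in> hom C b a" "Comp C f' f = Id C a" "Comp C f f' = Id C b"
    and g': "g' \<in> hom C c b" "Comp C g' g = Id C b" "Comp C g g' = Id C c"
    using f g unfolding iso_arrow_def inverse_arrows_def by (auto simp: hom_def)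
  have gf: "Comp C g f \<in> hom C a c" and fg': "Comp C f' g' \<in> hom C c a"
    by (rule Comp_in_hom[OF C f(1) g(1)], rule Comp_in_hom[OF C g'(1) f'(1)])
  have "Comp C (Comp C f' g') (Comp C g f) = Comp C f' (Comp C g' (Comp C g f))"
    using Comp_assoc[OF C gf g'(1) f'(1)] by simp
  also have "Comp C g' (Comp C g f) = f"
    using Comp_assoc[OF C f(1) g(1) g'(1)] Comp_Id_left[OF C f(1)] g' by simp
  finally have 1: "Comp C (Comp C f' g') (Comp C g f) = Id C a" using f' by simp
  have "Comp C (Comp C g f) (Comp C f' g') = Comp C g (Comp C f (Comp C f' g'))"
    using Comp_assoc[OF C fg' f(1) g(1)] by simp
  also have "Comp C f (Comp C f' g') = g'"
    using Comp_assoc[OF C g'(1) f'(1) f(1)] Comp_Id_left[OF C g'(1)] f' by simp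
  finally have 2: "Comp C (Comp C g f) (Comp C f' g') = Id C c" using g' by simp
  show ?thesis
    unfolding iso_arrow_def inverse_arrows_def
    using 1 2 gf fg' homD[OF gf] by auto
qed

lemma iso_arrow_mono:
  assumes C: "category C" and f: "f \<in> hom C b c" "iso_arrow C f"
    and g: "g \<in> hom C a b" and h: "h \<in> hom C a b" and eq: "Comp C f g = Comp C f h"
  shows "g = h"
proof -
  obtain f' where f': "f' \<in> hom C c b" "Comp C f' f = Id C b"
    using f unfolding iso_arrow_def inverse_arrows_def by (auto simp: hom_def)
  have "g = Comp C (Comp C f' f) g" using Comp_Id_left[OF C g] f' by simp
  also have "\<dots> = Comp C f' (Comp C f h)" using Comp_assoc[OF C g f(1) f'(1)] eq by simp
  also have "\<dots> = h" using Comp_assoc[OF C h f(1) f'(1)] Comp_Id_left[OF C h] f' by simp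
  finally show ?thesis .
qed

lemma nat_iso_nat_id: "is_functor C D F \<Longrightarrow> nat_iso C D F F (nat_id C D F)"
  by (simp add: nat_iso_def nat_trans_nat_id iso_arrow_Id functor_categoryD functor_Obj)

lemma nat_iso_vcomp:
  assumes "nat_iso C D F G \<alpha>" "nat_iso C D G H \<beta>"
  shows "nat_iso C D F H (vcomp C D \<beta> \<alpha>)"
  using assms nat_trans_vcomp[of C D F G \<alpha> H \<beta>]
  by (auto simp: nat_iso_def
      intro!: iso_arrow_Comp[OF functor_categoryD(2)] nat_trans_hom dest: nat_trans_functorD)

lemma nat_iso_rwhisk:
  "is_functor B C K \<Longrightarrow> nat_iso C D F G \<alpha> \<Longrightarrow>
     nat_iso B D (functor_comp B F K) (functor_comp B G K) (rwhisk B \<alpha> K)"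
  by (simp add: nat_iso_def nat_trans_rwhisk functor_Obj)

section \<open>The slice 2-category\<close>

lemma slice_1cellI:
  assumes "is_slice_obj A c" "is_slice_obj A d" "is_functor (fst c) (fst d) (fst F)"
    and "nat_iso (fst c) A (functor_comp (fst c) (snd d) (fst F)) (snd c) (snd F)"
    and "s = Strict \<Longrightarrow> functor_comp (fst c) (snd d) (fst F) = snd c"
    and "s = Strict \<Longrightarrow> snd F = nat_id (fst c) A (snd c)"
  shows "slice_1cell s A c d F"
  using assms by (simp add: slice_1cell_def)

lemma slice_1cell_if_triangle_commutes:
  assumes "is_slice_obj A c" "is_slice_obj A d" "is_functor (fst c) (fst d) F"
    and "functor_comp (fst c) (snd d) F = snd c"
  shows "slice_1cell s A c d (F, nat_id (fst c) A (snd c))"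
  by (rule slice_1cellI) (use assms in \<open>simp_all add: is_slice_obj_def nat_iso_nat_id\<close>)

lemma slice_1cellD:
  assumes "slice_1cell s A c d F"
  shows "is_functor (fst c) A (snd c)" "is_functor (fst d) A (snd d)"
    and "is_functor (fst c) (fst d) (fst F)"
    and "nat_iso (fst c) A (functor_comp (fst c) (snd d) (fst F)) (snd c) (snd F)"
    and "nat_trans (fst c) A (functor_comp (fst c) (snd d) (fst F)) (snd c) (snd F)"
  using assms by (auto simp: slice_1cell_def is_slice_obj_def nat_iso_def)

lemma slice_1cell_sliceD:
  assumes "slice_1cell s A c d F"
  shows "is_slice_obj A c" "is_slice_obj A d"
  using assms by (auto simp: slice_1cell_def)

lemma slice_2cellI:
  assumes "slice_1cell s A c d F" "slice_1cell s A c d G"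
    and "nat_trans (fst c) (fst d) (fst F) (fst G) \<alpha>"
    and "vcomp (fst c) A (snd G) (lwhisk (fst c) (snd d) \<alpha>) = snd F"
  shows "slice_2cell s A c d F G \<alpha>"
  using assms by (simp add: slice_2cell_def)

lemma slice_2cellD:
  assumes "slice_2cell s A c d F G \<alpha>"
  shows "slice_1cell s A c d F" "slice_1cell s A c d G"
    and "nat_trans (fst c) (fst d) (fst F) (fst G) \<alpha>"
    and "vcomp (fst c) A (snd G) (lwhisk (fst c) (snd d) \<alpha>) = snd F"
  using assms by (auto simp: slice_2cell_def)

lemma slice_comp_simps [simp]:
  "fst (slice_comp A c G F) = functor_comp (fst c) (fst G) (fst F)"
  "snd (slice_comp A c G F) = vcomp (fst c) A (snd F) (rwhisk (fst c) (snd G) (fst F))"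
  by (simp_all add: slice_comp_def)

lemma slice_1cell_comp:
  assumes F: "slice_1cell s A c d F" and G: "slice_1cell s A d e G"
  shows "slice_1cell s A c e (slice_comp A c G F)"
proof (rule slice_1cellI)
  note f = slice_1cellD[OF F] and g = slice_1cellD[OF G]
  show "is_slice_obj A c" "is_slice_obj A e"
    using slice_1cell_sliceD F G by blast+
  show "is_functor (fst c) (fst e) (fst (slice_comp A c G F))"
    by (simp add: is_functor_comp[OF f(3) g(3)])
  show "nat_iso (fst c) A (functor_comp (fst c) (snd e) (fst (slice_comp A c G F))) (snd c)
      (snd (slice_comp A c G F))"
    using nat_iso_vcomp[OF nat_iso_rwhisk[OF f(3) g(4)] f(4)]
    by (simp add: functor_comp_assoc[OF f(3)])
  assume s: "s = Strict"
  have fs: "functor_comp (fst c) (snd d) (fst F) = snd c" "snd F = nat_id (fst c) A (snd c)"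
    and gs: "functor_comp (fst d) (snd e) (fst G) = snd d" "snd G = nat_id (fst d) A (snd d)"
    using F G s by (auto simp: slice_1cell_def)
  show "functor_comp (fst c) (snd e) (fst (slice_comp A c G F)) = snd c"
    using fs gs by (simp add: functor_comp_assoc[OF f(3)])
  show "snd (slice_comp A c G F) = nat_id (fst c) A (snd c)"
    using fs gs by (simp add: rwhisk_nat_id[OF f(3)] vcomp_nat_id_left[OF nat_trans_nat_id[OF f(1)]])
qed

lemma slice_comp_assoc:
  assumes F: "slice_1cell s A b c F" and G: "slice_1cell s A c d G" and H: "slice_1cell s A d e H"
  shows "slice_comp A b H (slice_comp A b G F) = slice_comp A b (slice_comp A c H G) F"
proof (rule prod_eqI)
  note f = slice_1cellD[OF F] and g = slice_1cellD[OF G] and h = slice_1cellD[OF H]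
  show "fst (slice_comp A b H (slice_comp A b G F)) = fst (slice_comp A b (slice_comp A c H G) F)"
    by (simp add: functor_comp_assoc[OF f(3)])
  have 1: "rwhisk (fst b) (snd H) (functor_comp (fst b) (fst G) (fst F)) =
      rwhisk (fst b) (rwhisk (fst c) (snd H) (fst G)) (fst F)"
    by (rule extensionalityI[where A="Obj (fst b)"]) (simp_all add: functor_Obj[OF f(3)])
  show "snd (slice_comp A b H (slice_comp A b G F)) = snd (slice_comp A b (slice_comp A c H G) F)"
    using vcomp_assoc[OF nat_trans_rwhisk[OF f(3) nat_trans_rwhisk[OF g(3) h(5)]]
        nat_trans_rwhisk[OF f(3) g(5)] f(5)]
    by (simp add: rwhisk_vcomp[OF f(3)] 1)
qed

lemma slice_1cell_id:
  assumes c: "is_slice_obj A c"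
  shows "slice_1cell s A c c (slice_id A c)"
  using c slice_1cell_if_triangle_commutes[OF c c, of "functor_id (fst c)" s]
  by (simp add: slice_id_def is_slice_obj_def is_functor_id functor_categoryD(1) functor_comp_id_right)

lemma slice_2cell_id:
  assumes F: "slice_1cell s A c d F"
  shows "slice_2cell s A c d F F (nat_id (fst c) (fst d) (fst F))"
  using slice_1cellD[OF F]
  by (intro slice_2cellI[OF F F]) (simp_all add: nat_trans_nat_id lwhisk_nat_id vcomp_nat_id_right)

lemma slice_2cell_vcomp:
  assumes a: "slice_2cell s A c d F G \<alpha>" and b: "slice_2cell s A c d G H \<beta>"
  shows "slice_2cell s A c d F H (vcomp (fst c) (fst d) \<beta> \<alpha>)"
proof (rule slice_2cellI[OF slice_2cellD(1)[OF a] slice_2cellD(2)[OF b]])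
  note a = slice_2cellD[OF a] and b = slice_2cellD[OF b]
  note d = slice_1cellD(2)[OF a(1)]
  show "nat_trans (fst c) (fst d) (fst F) (fst H) (vcomp (fst c) (fst d) \<beta> \<alpha>)"
    by (rule nat_trans_vcomp[OF a(3) b(3)])
  show "vcomp (fst c) A (snd H) (lwhisk (fst c) (snd d) (vcomp (fst c) (fst d) \<beta> \<alpha>)) = snd F"
    using vcomp_assoc[OF nat_trans_lwhisk[OF a(3) d] nat_trans_lwhisk[OF b(3) d]
        slice_1cellD(5)[OF b(2)]] a(4) b(4)
    by (simp add: lwhisk_vcomp[OF a(3) b(3) d])
qed

lemma slice_2cell_rwhisk:
  assumes h: "slice_1cell s A b c h" and a: "slice_2cell s A c d F G \<alpha>"
  shows "slice_2cell s A b d (slice_comp A b F h) (slice_comp A b G h) (rwhisk (fst b) \<alpha> (fst h))"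
proof (rule slice_2cellI)
  note a' = slice_2cellD[OF a] and h' = slice_1cellD[OF h]
  note d = slice_1cellD(2)[OF a'(1)]
  show "slice_1cell s A b d (slice_comp A b F h)" "slice_1cell s A b d (slice_comp A b G h)"
    using slice_1cell_comp h a' by blast+
  show "nat_trans (fst b) (fst d) (fst (slice_comp A b F h)) (fst (slice_comp A b G h))
      (rwhisk (fst b) \<alpha> (fst h))"
    by (simp add: nat_trans_rwhisk[OF h'(3) a'(3)])
  have 1: "lwhisk (fst b) (snd d) (rwhisk (fst b) \<alpha> (fst h)) =
      rwhisk (fst b) (lwhisk (fst c) (snd d) \<alpha>) (fst h)"
    by (rule extensionalityI[where A="Obj (fst b)"]) (simp_all add: functor_Obj[OF h'(3)])
  show "vcomp (fst b) A (snd (slice_comp A b G h)) (lwhisk (fst b) (snd d) (rwhisk (fst b) \<alpha> (fst h)))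
      = snd (slice_comp A b F h)"
    using vcomp_assoc[OF nat_trans_rwhisk[OF h'(3) nat_trans_lwhisk[OF a'(3) d]]
        nat_trans_rwhisk[OF h'(3) slice_1cellD(5)[OF a'(2)]] h'(5)]
      rwhisk_vcomp[OF h'(3), of A "snd G" "lwhisk (fst c) (snd d) \<alpha>"] a'(4)
    by (simp add: 1)
qed

text \<open>With \<open>p\<close> the projection of \<open>d\<close>, the triangle of \<open>k\<rho>\<close> is obtained by pasting the triangle of
  \<open>\<rho>\<close> with the naturality square of \<open>\<phi> : p k \<Rightarrow> q\<close> at the components of \<open>\<rho>\<close>.\<close>

lemma slice_2cell_lwhisk:
  assumes k: "slice_1cell s A c d k" and r: "slice_2cell s A b c h h' \<rho>"
  shows "slice_2cell s A b d (slice_comp A b k h) (slice_comp A b k h') (lwhisk (fst b) (fst k) \<rho>)"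
proof (rule slice_2cellI)
  note r' = slice_2cellD[OF r] and k' = slice_1cellD[OF k]
  note h = slice_1cellD[OF r'(1)] and h' = slice_1cellD[OF r'(2)]
  note A = functor_categoryD(2)[OF h(1)] and B = functor_categoryD(1)[OF h(1)]
  show "slice_1cell s A b d (slice_comp A b k h)" "slice_1cell s A b d (slice_comp A b k h')"
    using slice_1cell_comp k r' by blast+
  show "nat_trans (fst b) (fst d) (fst (slice_comp A b k h)) (fst (slice_comp A b k h'))
      (lwhisk (fst b) (fst k) \<rho>)"
    by (simp add: nat_trans_lwhisk[OF r'(3) k'(3)])
  show "vcomp (fst b) A (snd (slice_comp A b k h')) (lwhisk (fst b) (snd d) (lwhisk (fst b) (fst k) \<rho>))
      = snd (slice_comp A b k h)"
  proof (rule extensionalityI[where A="Obj (fst b)"])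
    fix x assume x: "x \<in> Obj (fst b)"
    let ?r = "\<rho> x" and ?hx = "fobj (fst h) x" and ?hx' = "fobj (fst h') x"
    have r: "?r \<in> hom (fst c) ?hx ?hx'" by (rule nat_trans_hom[OF r'(3) x])
    note xc = functor_Obj[OF h(3) x] functor_Obj[OF h'(3) x]
    have 1: "snd k ?hx' \<in> hom A (fobj (snd d) (fobj (fst k) ?hx')) (fobj (snd c) ?hx')"
      using nat_trans_hom[OF k'(5) xc(2)] xc by simp
    have 2: "farr (snd d) (farr (fst k) ?r) \<in>
        hom A (fobj (snd d) (fobj (fst k) ?hx)) (fobj (snd d) (fobj (fst k) ?hx'))"
      by (rule functor_hom[OF k'(2) functor_hom[OF k'(3) r]])
    have 3: "snd h' x \<in> hom A (fobj (snd c) ?hx') (fobj (snd b) x)"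
      using nat_trans_hom[OF h'(5) x] x by simp
    have 4: "snd k ?hx \<in> hom A (fobj (snd d) (fobj (fst k) ?hx)) (fobj (snd c) ?hx)"
      using nat_trans_hom[OF k'(5) xc(1)] xc by simp
    have 5: "farr (snd c) ?r \<in> hom A (fobj (snd c) ?hx) (fobj (snd c) ?hx')"
      by (rule functor_hom[OF k'(1) r])
    have "Comp A (Comp A (snd h' x) (snd k ?hx')) (farr (snd d) (farr (fst k) ?r)) =
        Comp A (snd h' x) (Comp A (snd k ?hx') (farr (snd d) (farr (fst k) ?r)))"
      by (rule Comp_assoc[OF A 2 1 3, symmetric])
    also have "\<dots> = Comp A (snd h' x) (Comp A (farr (snd c) ?r) (snd k ?hx))"
      using nat_trans_natural[OF k'(5) r] homD(1)[OF r] by simp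
    also have "\<dots> = Comp A (Comp A (snd h' x) (farr (snd c) ?r)) (snd k ?hx)"
      by (rule Comp_assoc[OF A 4 5 3])
    also have "Comp A (snd h' x) (farr (snd c) ?r) = snd h x"
      using fun_cong[OF r'(4), of x] x by simp
    finally show "vcomp (fst b) A (snd (slice_comp A b k h'))
        (lwhisk (fst b) (snd d) (lwhisk (fst b) (fst k) \<rho>)) x = snd (slice_comp A b k h) x"
      using x by simp
  qed simp_all
qed

lemma slice_hom_simps [simp]:
  "F \<in> Obj (slice_hom s A c d) \<longleftrightarrow> slice_1cell s A c d F"
  "(F, \<alpha>, G) \<in> Arr (slice_hom s A c d) \<longleftrightarrow> slice_2cell s A c d F G \<alpha>"
  "Dom (slice_hom s A c d) (F, \<alpha>, G) = F"
  "Cod (slice_hom s A c d) (F, \<alpha>, G) = G"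
  "Id (slice_hom s A c d) F = (F, nat_id (fst c) (fst d) (fst F), F)"
  "Comp (slice_hom s A c d) (G, \<beta>, H) (F, \<alpha>, G') = (F, vcomp (fst c) (fst d) \<beta> \<alpha>, H)"
  by (simp_all add: slice_hom_def)

lemma slice_hom_ArrE:
  assumes "f \<in> Arr (slice_hom s A c d)"
  obtains F \<alpha> G where "f = (F, \<alpha>, G)" "slice_2cell s A c d F G \<alpha>"
  using assms by (auto simp: slice_hom_def)

lemma slice_hom_homE:
  assumes "f \<in> hom (slice_hom s A c d) F G"
  obtains \<alpha> where "f = (F, \<alpha>, G)" "slice_2cell s A c d F G \<alpha>"
  using assms by (auto simp: hom_def elim!: slice_hom_ArrE)

lemma category_slice_hom: "category (slice_hom s A c d)"
proof (rule categoryI)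
  fix f assume "f \<in> Arr (slice_hom s A c d)"
  then obtain F \<alpha> G where f: "f = (F, \<alpha>, G)" "slice_2cell s A c d F G \<alpha>" by (rule slice_hom_ArrE)
  note a = slice_2cellD[OF f(2)]
  show "Dom (slice_hom s A c d) f \<in> Obj (slice_hom s A c d)"
    "Cod (slice_hom s A c d) f \<in> Obj (slice_hom s A c d)"
    using f a by simp_all
  show "Comp (slice_hom s A c d) f (Id (slice_hom s A c d) (Dom (slice_hom s A c d) f)) = f"
    "Comp (slice_hom s A c d) (Id (slice_hom s A c d) (Cod (slice_hom s A c d) f)) f = f"
    using f by (simp_all add: vcomp_nat_id_left[OF a(3)] vcomp_nat_id_right[OF a(3)])
  fix g assume "g \<in> Arr (slice_hom s A c d)" "Dom (slice_hom s A c d) g = Cod (slice_hom s A c d) f"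
  then obtain \<beta> H where g: "g = (G, \<beta>, H)" "slice_2cell s A c d G H \<beta>"
    using f by (auto elim!: slice_hom_ArrE)
  show "Comp (slice_hom s A c d) g f \<in>
      hom (slice_hom s A c d) (Dom (slice_hom s A c d) f) (Cod (slice_hom s A c d) g)"
    using f g by (simp add: hom_def slice_2cell_vcomp)
  fix h assume "h \<in> Arr (slice_hom s A c d)" "Dom (slice_hom s A c d) h = Cod (slice_hom s A c d) g"
  then obtain \<gamma> K where h: "h = (H, \<gamma>, K)" "slice_2cell s A c d H K \<gamma>"
    using g by (auto elim!: slice_hom_ArrE)
  show "Comp (slice_hom s A c d) h (Comp (slice_hom s A c d) g f) =
      Comp (slice_hom s A c d) (Comp (slice_hom s A c d) h g) f"
    using f g h by (simp add: vcomp_assoc[OF a(3) slice_2cellD(3)[OF g(2)] slice_2cellD(3)[OF h(2)]])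
qed (simp add: hom_def slice_2cell_id)

lemma isomorphic_refl:
  assumes "category C" "a \<in> Obj C"
  shows "isomorphic C a a"
  using Id_in_hom[OF assms] iso_arrow_Id[OF assms] unfolding isomorphic_def by blast

text \<open>The inverse of an isomorphism that commutes with the projections commutes with them too, so
  both composites in the slice are identities on the nose.\<close>

lemma slice_equivalent_if_cat_isomorphism:
  assumes c: "is_slice_obj A c" and d: "is_slice_obj A d"
    and F: "cat_isomorphism (fst c) (fst d) F" and tri: "functor_comp (fst c) (snd d) F = snd c"
  shows "slice_equivalent s A c d"
proof -
  obtain G where Ff: "is_functor (fst c) (fst d) F" and G: "is_functor (fst d) (fst c) G"
    and GF: "functor_comp (fst c) G F = functor_id (fst c)"
    and FG: "functor_comp (fst d) F G = functor_id (fst d)"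
    using F unfolding cat_isomorphism_def by blast
  have c': "is_functor (fst c) A (snd c)" and d': "is_functor (fst d) A (snd d)"
    using c d by (auto simp: is_slice_obj_def)
  have tri': "functor_comp (fst d) (snd c) G = snd d"
    using functor_comp_assoc[OF G, of "snd d" F] tri FG functor_comp_id_right[OF d'] by simp
  let ?F = "(F, nat_id (fst c) A (snd c))" and ?G = "(G, nat_id (fst d) A (snd d))"
  have 1: "slice_1cell s A c d ?F" "slice_1cell s A d c ?G"
    by (rule slice_1cell_if_triangle_commutes; fact)+
  have "slice_comp A c ?G ?F = slice_id A c"
    using tri
    by (auto intro!: prod_eqI simp: slice_id_def GF rwhisk_nat_id[OF Ff] vcomp_nat_id_left[OF nat_trans_nat_id[OF c']])
  moreover have "slice_comp A d ?F ?G = slice_id A d"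
    using tri'
    by (auto intro!: prod_eqI simp: slice_id_def FG rwhisk_nat_id[OF G] vcomp_nat_id_left[OF nat_trans_nat_id[OF d']])
  ultimately show ?thesis
    unfolding slice_equivalent_def
    using 1 isomorphic_refl[OF category_slice_hom] slice_1cell_id[OF c] slice_1cell_id[OF d]
    by (metis slice_hom_simps(1))
qed

section \<open>Modules over a monad in the slice and the comparison functor\<close>

locale slice_monad_on =
  fixes s :: slice_kind and A :: "('a, 'f) cat" and c :: "('o, 'm, 'a, 'f) slice_obj"
    and t :: "('o, 'm, 'o, 'm, 'f) slice_cell" and \<eta> \<mu> :: "'o \<Rightarrow> 'm"
  assumes slice_monad: "slice_monad s A c t \<eta> \<mu>"
begin

lemma t_1cell: "slice_1cell s A c c t"
  using slice_monad by (simp add: slice_monad_def Let_def)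

lemmas T_functor = slice_1cellD(3)[OF t_1cell]

abbreviation is_module where
  "is_module g m l \<equiv> slice_module s A g c t \<eta> \<mu> m l"

abbreviation Modules where
  "Modules g \<equiv> slice_Mod s A g c t \<eta> \<mu>"

lemma is_moduleD:
  assumes "is_module g m l"
  shows "slice_1cell s A g c m" "slice_2cell s A g c (slice_comp A g t m) m l"
    "nat_trans (fst g) (fst c) (functor_comp (fst g) (fst t) (fst m)) (fst m) l"
    and "x \<in> Obj (fst g) \<Longrightarrow> Comp (fst c) (l x) (\<eta> (fobj (fst m) x)) = Id (fst c) (fobj (fst m) x)"
    and "x \<in> Obj (fst g) \<Longrightarrow>
           Comp (fst c) (l x) (\<mu> (fobj (fst m) x)) = Comp (fst c) (l x) (farr (fst t) (l x))"
proof -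
  show 1: "slice_1cell s A g c m" and 2: "slice_2cell s A g c (slice_comp A g t m) m l"
    using assms by (simp_all add: slice_module_def Let_def)
  show "nat_trans (fst g) (fst c) (functor_comp (fst g) (fst t) (fst m)) (fst m) l"
    using slice_2cellD(3)[OF 2] by simp
  have u: "vcomp (fst g) (fst c) l (rwhisk (fst g) \<eta> (fst m)) = nat_id (fst g) (fst c) (fst m)"
    and a: "vcomp (fst g) (fst c) l (rwhisk (fst g) \<mu> (fst m)) =
            vcomp (fst g) (fst c) l (lwhisk (fst g) (fst t) l)"
    using assms by (simp_all add: slice_module_def Let_def)
  show "Comp (fst c) (l x) (\<eta> (fobj (fst m) x)) = Id (fst c) (fobj (fst m) x)"
    if "x \<in> Obj (fst g)" using fun_cong[OF u, of x] that by simp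
  show "Comp (fst c) (l x) (\<mu> (fobj (fst m) x)) = Comp (fst c) (l x) (farr (fst t) (l x))"
    if "x \<in> Obj (fst g)" using fun_cong[OF a, of x] that by simp
qed

lemma is_moduleI:
  assumes "slice_1cell s A g c m" "slice_2cell s A g c (slice_comp A g t m) m l"
    and "\<And>x. x \<in> Obj (fst g) \<Longrightarrow>
           Comp (fst c) (l x) (\<eta> (fobj (fst m) x)) = Id (fst c) (fobj (fst m) x)"
    and "\<And>x. x \<in> Obj (fst g) \<Longrightarrow>
           Comp (fst c) (l x) (\<mu> (fobj (fst m) x)) = Comp (fst c) (l x) (farr (fst t) (l x))"
  shows "is_module g m l"
  unfolding slice_module_def Let_def
  using assms(1,2)
  by (auto intro!: extensionalityI[where A="Obj (fst g)"] simp: assms(3,4))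

definition module_morphism where
  "module_morphism g m l m' l' \<sigma> \<longleftrightarrow> is_module g m l \<and> is_module g m' l' \<and>
     slice_2cell s A g c m m' \<sigma> \<and>
     vcomp (fst g) (fst c) \<sigma> l = vcomp (fst g) (fst c) l' (lwhisk (fst g) (fst t) \<sigma>)"

lemma module_morphismI:
  assumes "is_module g m l" "is_module g m' l'" "slice_2cell s A g c m m' \<sigma>"
    and "\<And>x. x \<in> Obj (fst g) \<Longrightarrow>
           Comp (fst c) (\<sigma> x) (l x) = Comp (fst c) (l' x) (farr (fst t) (\<sigma> x))"
  shows "module_morphism g m l m' l' \<sigma>"
  unfolding module_morphism_def
  using assms(1-3) by (auto intro!: extensionalityI[where A="Obj (fst g)"] simp: assms(4))

lemma module_morphismD:
  assumes "module_morphism g m l m' l' \<sigma>"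
  shows "is_module g m l" "is_module g m' l'" "slice_2cell s A g c m m' \<sigma>"
    "nat_trans (fst g) (fst c) (fst m) (fst m') \<sigma>"
    and "x \<in> Obj (fst g) \<Longrightarrow>
           Comp (fst c) (\<sigma> x) (l x) = Comp (fst c) (l' x) (farr (fst t) (\<sigma> x))"
proof -
  show "is_module g m l" "is_module g m' l'" and 1: "slice_2cell s A g c m m' \<sigma>"
    using assms by (simp_all add: module_morphism_def)
  show "nat_trans (fst g) (fst c) (fst m) (fst m') \<sigma>" by (rule slice_2cellD(3)[OF 1])
  have "vcomp (fst g) (fst c) \<sigma> l = vcomp (fst g) (fst c) l' (lwhisk (fst g) (fst t) \<sigma>)"
    using assms by (simp add: module_morphism_def)
  from fun_cong[OF this, of x]
  show "Comp (fst c) (\<sigma> x) (l x) = Comp (fst c) (l' x) (farr (fst t) (\<sigma> x))"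
    if "x \<in> Obj (fst g)" using that by simp
qed

lemma Modules_simps [simp]:
  "(m, l) \<in> Obj (Modules g) \<longleftrightarrow> is_module g m l"
  "((m, l), \<sigma>, (m', l')) \<in> Arr (Modules g) \<longleftrightarrow> module_morphism g m l m' l' \<sigma>"
  "Dom (Modules g) (p, \<sigma>, q) = p"
  "Cod (Modules g) (p, \<sigma>, q) = q"
  "Id (Modules g) (m, l) = ((m, l), nat_id (fst g) (fst c) (fst m), (m, l))"
  "Comp (Modules g) (q, \<tau>, r) (p, \<sigma>, q') = (p, vcomp (fst g) (fst c) \<tau> \<sigma>, r)"
  by (simp_all add: slice_Mod_def module_morphism_def)

lemma Modules_ArrE:
  assumes "f \<in> Arr (Modules g)"
  obtains m l \<sigma> m' l' where "f = ((m, l), \<sigma>, (m', l'))" "module_morphism g m l m' l' \<sigma>"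
  using assms unfolding slice_Mod_def module_morphism_def by auto

lemma module_morphism_id:
  assumes m: "is_module g m l"
  shows "module_morphism g m l m l (nat_id (fst g) (fst c) (fst m))"
proof (rule module_morphismI[OF m m])
  note m' = is_moduleD[OF m]
  note M = slice_1cellD(3)[OF m'(1)]
  show "slice_2cell s A g c m m (nat_id (fst g) (fst c) (fst m))"
    by (rule slice_2cell_id[OF m'(1)])
  fix x assume x: "x \<in> Obj (fst g)"
  have l: "l x \<in> hom (fst c) (fobj (fst t) (fobj (fst m) x)) (fobj (fst m) x)"
    using nat_trans_hom[OF m'(3) x] x by simp
  show "Comp (fst c) (nat_id (fst g) (fst c) (fst m) x) (l x) =
      Comp (fst c) (l x) (farr (fst t) (nat_id (fst g) (fst c) (fst m) x))"
    using x Comp_Id_left[OF functor_categoryD(2)[OF M] l] Comp_Id_right[OF functor_categoryD(2)[OF M] l]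
    by (simp add: functor_Id[OF T_functor functor_Obj[OF M]])
qed

lemma module_morphism_vcomp:
  assumes \<sigma>: "module_morphism g m l m' l' \<sigma>" and \<tau>: "module_morphism g m' l' m'' l'' \<tau>"
  shows "module_morphism g m l m'' l'' (vcomp (fst g) (fst c) \<tau> \<sigma>)"
proof (rule module_morphismI)
  note S = module_morphismD[OF \<sigma>] and T = module_morphismD[OF \<tau>]
  note C = functor_categoryD(2)[OF T_functor]
  show "is_module g m l" "is_module g m'' l''" by (fact S T)+
  show "slice_2cell s A g c m m'' (vcomp (fst g) (fst c) \<tau> \<sigma>)"
    by (rule slice_2cell_vcomp[OF S(3) T(3)])
  fix x assume x: "x \<in> Obj (fst g)"
  have l: "l x \<in> hom (fst c) (fobj (fst t) (fobj (fst m) x)) (fobj (fst m) x)"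
    and l': "l' x \<in> hom (fst c) (fobj (fst t) (fobj (fst m') x)) (fobj (fst m') x)"
    and l'': "l'' x \<in> hom (fst c) (fobj (fst t) (fobj (fst m'') x)) (fobj (fst m'') x)"
    using nat_trans_hom[OF is_moduleD(3)[OF S(1)] x] nat_trans_hom[OF is_moduleD(3)[OF S(2)] x]
      nat_trans_hom[OF is_moduleD(3)[OF T(2)] x] x by simp_all
  note s = nat_trans_hom[OF S(4) x] and t = nat_trans_hom[OF T(4) x]
  note Ts = functor_hom[OF T_functor s] and Tt = functor_hom[OF T_functor t]
  have "Comp (fst c) (Comp (fst c) (\<tau> x) (\<sigma> x)) (l x) =
      Comp (fst c) (\<tau> x) (Comp (fst c) (l' x) (farr (fst t) (\<sigma> x)))"
    using Comp_assoc[OF C l s t] S(5)[OF x] by simp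
  also have "\<dots> = Comp (fst c) (Comp (fst c) (l'' x) (farr (fst t) (\<tau> x))) (farr (fst t) (\<sigma> x))"
    using Comp_assoc[OF C Ts l' t] T(5)[OF x] by simp
  also have "\<dots> = Comp (fst c) (l'' x) (farr (fst t) (Comp (fst c) (\<tau> x) (\<sigma> x)))"
    using Comp_assoc[OF C Ts Tt l''] functor_Comp[OF T_functor s t] by simp
  finally show "Comp (fst c) (vcomp (fst g) (fst c) \<tau> \<sigma> x) (l x) =
      Comp (fst c) (l'' x) (farr (fst t) (vcomp (fst g) (fst c) \<tau> \<sigma> x))"
    using x by simp
qed

lemma category_Modules: "category (Modules g)"
proof (rule categoryI)
  fix f assume "f \<in> Arr (Modules g)"
  then obtain m l \<sigma> m' l' where f: "f = ((m, l), \<sigma>, (m', l'))" "module_morphism g m l m' l' \<sigma>"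
    by (rule Modules_ArrE)
  note S = module_morphismD[OF f(2)]
  show "Dom (Modules g) f \<in> Obj (Modules g)" "Cod (Modules g) f \<in> Obj (Modules g)"
    using f S by simp_all
  show "Comp (Modules g) f (Id (Modules g) (Dom (Modules g) f)) = f"
    "Comp (Modules g) (Id (Modules g) (Cod (Modules g) f)) f = f"
    using f by (simp_all add: vcomp_nat_id_left[OF S(4)] vcomp_nat_id_right[OF S(4)])
  fix f' assume "f' \<in> Arr (Modules g)" "Dom (Modules g) f' = Cod (Modules g) f"
  then obtain \<tau> m'' l'' where f': "f' = ((m', l'), \<tau>, (m'', l''))" "module_morphism g m' l' m'' l'' \<tau>"
    using f by (auto elim!: Modules_ArrE)
  show "Comp (Modules g) f' f \<in> hom (Modules g) (Dom (Modules g) f) (Cod (Modules g) f')"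
    using f f' by (simp add: hom_def module_morphism_vcomp)
  fix f'' assume "f'' \<in> Arr (Modules g)" "Dom (Modules g) f'' = Cod (Modules g) f'"
  then obtain \<upsilon> n k where f'': "f'' = ((m'', l''), \<upsilon>, (n, k))" "module_morphism g m'' l'' n k \<upsilon>"
    using f' by (auto elim!: Modules_ArrE)
  show "Comp (Modules g) f'' (Comp (Modules g) f' f) = Comp (Modules g) (Comp (Modules g) f'' f') f"
    using f f' f''
    by (simp add: vcomp_assoc[OF S(4) module_morphismD(4)[OF f'(2)] module_morphismD(4)[OF f''(2)]])
next
  fix a assume "a \<in> Obj (Modules g)"
  then show "Id (Modules g) a \<in> hom (Modules g) a a"
    by (cases a) (simp add: hom_def module_morphism_id)
qed

text \<open>Restricting the module \<open>(m, l)\<close> along \<open>h\<close> whiskers its action; the triangle of \<open>l h\<close> is that of a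
  2-cell out of \<open>(t m) h\<close>, which is the same 1-cell as \<open>t (m h)\<close>.\<close>

lemma is_module_precomp:
  assumes m: "is_module g m l" and h: "slice_1cell s A g' g h"
  shows "is_module g' (slice_comp A g' m h) (rwhisk (fst g') l (fst h))"
proof (rule is_moduleI)
  note m' = is_moduleD[OF m] and H = slice_1cellD(3)[OF h]
  show "slice_1cell s A g' c (slice_comp A g' m h)" by (rule slice_1cell_comp[OF h m'(1)])
  show "slice_2cell s A g' c (slice_comp A g' t (slice_comp A g' m h)) (slice_comp A g' m h)
      (rwhisk (fst g') l (fst h))"
    using slice_2cell_rwhisk[OF h m'(2)] slice_comp_assoc[OF h m'(1) t_1cell] by simp
qed (use is_moduleD(4,5)[OF m] functor_Obj[OF slice_1cellD(3)[OF h]] in simp_all)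

end

locale slice_monad_module = slice_monad_on s A c t \<eta> \<mu>
  for s and A :: "('a, 'f) cat" and c :: "('o, 'm, 'a, 'f) slice_obj" and t \<eta> \<mu> +
  fixes e :: "('e, 'i, 'a, 'f) slice_obj" and u :: "('e, 'i, 'o, 'm, 'f) slice_cell" and l :: "'e \<Rightarrow> 'm"
  assumes module: "slice_module s A e c t \<eta> \<mu> u l"
begin

abbreviation comparison where
  "comparison g \<equiv> EM_comparison s A g e u l"

lemmas u_1cell = is_moduleD(1)[OF module]

text \<open>The naturality of \<open>l\<close> at the components of a 2-cell \<open>\<sigma>\<close> says exactly that \<open>u\<sigma>\<close> is a
  morphism of modules.\<close>

lemma module_morphism_lwhisk:
  assumes \<sigma>: "slice_2cell s A g e k k' \<sigma>"
  shows "module_morphism g (slice_comp A g u k) (rwhisk (fst g) l (fst k))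
           (slice_comp A g u k') (rwhisk (fst g) l (fst k')) (lwhisk (fst g) (fst u) \<sigma>)"
proof (rule module_morphismI)
  note S = slice_2cellD[OF \<sigma>]
  show "is_module g (slice_comp A g u k) (rwhisk (fst g) l (fst k))"
    "is_module g (slice_comp A g u k') (rwhisk (fst g) l (fst k'))"
    by (rule is_module_precomp[OF module S(1)], rule is_module_precomp[OF module S(2)])
  show "slice_2cell s A g c (slice_comp A g u k) (slice_comp A g u k') (lwhisk (fst g) (fst u) \<sigma>)"
    by (rule slice_2cell_lwhisk[OF u_1cell \<sigma>])
  fix x assume x: "x \<in> Obj (fst g)"
  show "Comp (fst c) (lwhisk (fst g) (fst u) \<sigma> x) (rwhisk (fst g) l (fst k) x) =
      Comp (fst c) (rwhisk (fst g) l (fst k') x) (farr (fst t) (lwhisk (fst g) (fst u) \<sigma> x))"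
    using x nat_trans_natural[OF is_moduleD(3)[OF module] nat_trans_hom[OF S(3) x]]
      homD(1)[OF nat_trans_hom[OF S(3) x]] by simp
qed

lemma comparison_simps [simp]:
  "slice_1cell s A g e k \<Longrightarrow> fobj (comparison g) k = (slice_comp A g u k, rwhisk (fst g) l (fst k))"
  "slice_2cell s A g e k k' \<sigma> \<Longrightarrow> farr (comparison g) (k, \<sigma>, k') =
     ((slice_comp A g u k, rwhisk (fst g) l (fst k)), lwhisk (fst g) (fst u) \<sigma>,
      (slice_comp A g u k', rwhisk (fst g) l (fst k')))"
  by (simp_all add: EM_comparison_def mod_pre_obj_def)

lemma is_functor_comparison: "is_functor (slice_hom s A g e) (Modules g) (comparison g)"
proof (rule is_functorI)
  show "category (slice_hom s A g e)" "category (Modules g)"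
    by (rule category_slice_hom, rule category_Modules)
  show "fobj (comparison g) \<in> extensional (Obj (slice_hom s A g e))"
    "farr (comparison g) \<in> extensional (Arr (slice_hom s A g e))"
    by (simp_all add: EM_comparison_def)
  show "fobj (comparison g) k \<in> Obj (Modules g)" if "k \<in> Obj (slice_hom s A g e)" for k
    using that by (simp add: is_module_precomp[OF module])
  show "farr (comparison g) f \<in> hom (Modules g) (fobj (comparison g) a) (fobj (comparison g) b)"
    if f: "f \<in> hom (slice_hom s A g e) a b" for f a b
    using f by (rule slice_hom_homE) (auto simp: hom_def slice_2cellD module_morphism_lwhisk)
  show "farr (comparison g) (Id (slice_hom s A g e) k) = Id (Modules g) (fobj (comparison g) k)"
    if "k \<in> Obj (slice_hom s A g e)" for k
    using that slice_1cellD(3)[of s A g e k]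
    by (simp add: slice_2cell_id lwhisk_nat_id[OF _ slice_1cellD(3)[OF u_1cell]])
  show "farr (comparison g) (Comp (slice_hom s A g e) f' f) =
      Comp (Modules g) (farr (comparison g) f') (farr (comparison g) f)"
    if "f \<in> hom (slice_hom s A g e) k k'" and "f' \<in> hom (slice_hom s A g e) k' k''" for f f' k k' k''
    using that
    by (elim slice_hom_homE)
      (simp add: slice_2cell_vcomp lwhisk_vcomp[OF slice_2cellD(3) slice_2cellD(3) slice_1cellD(3)[OF u_1cell]])
qed

lemma comparison_natural:
  assumes h: "slice_1cell s A g' g h"
  shows "functor_comp (slice_hom s A g e) (comparison g') (hom_pre s A g' g e h) =
         functor_comp (slice_hom s A g e) (mod_pre s A g' g c t \<eta> \<mu> h) (comparison g)"
proof -
  note H = slice_1cellD(3)[OF h]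
  have 1: "rwhisk (fst g') l (functor_comp (fst g') (fst k) (fst h)) =
      rwhisk (fst g') (rwhisk (fst g) l (fst k)) (fst h)" for k
    by (rule extensionalityI[where A="Obj (fst g')"]) (simp_all add: functor_Obj[OF H])
  have 2: "lwhisk (fst g') (fst u) (rwhisk (fst g') \<sigma> (fst h)) =
      rwhisk (fst g') (lwhisk (fst g) (fst u) \<sigma>) (fst h)" for \<sigma>
    by (rule extensionalityI[where A="Obj (fst g')"]) (simp_all add: functor_Obj[OF H])
  have obj: "fobj (comparison g') (fobj (hom_pre s A g' g e h) k) =
      fobj (mod_pre s A g' g c t \<eta> \<mu> h) (fobj (comparison g) k)"
    if k: "slice_1cell s A g e k" for k
    using k slice_1cell_comp[OF h k] is_module_precomp[OF module k]
    by (simp add: hom_pre_def mod_pre_def mod_pre_obj_def slice_comp_assoc[OF h k u_1cell] 1)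
  have arr: "farr (comparison g') (farr (hom_pre s A g' g e h) (k, \<sigma>, k')) =
      farr (mod_pre s A g' g c t \<eta> \<mu> h) (farr (comparison g) (k, \<sigma>, k'))"
    if \<sigma>: "slice_2cell s A g e k k' \<sigma>" for k k' \<sigma>
    using \<sigma> slice_2cell_rwhisk[OF h \<sigma>] module_morphism_lwhisk[OF \<sigma>]
    by (simp add: hom_pre_def mod_pre_def mod_pre_obj_def slice_comp_assoc[OF h _ u_1cell]
        slice_2cellD(1,2)[OF \<sigma>] 1 2)
  show ?thesis
    unfolding functor_comp_def
    by (auto intro!: restrict_ext obj arr elim!: slice_hom_ArrE)
qed

lemma comparison_natural2:
  assumes r: "slice_2cell s A g' g h h' \<rho>"
  shows "lwhisk (slice_hom s A g e) (comparison g') (hom_pre2 s A g' g e h h' \<rho>) =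
         rwhisk (slice_hom s A g e) (mod_pre2 s A g' g c t \<eta> \<mu> h h' \<rho>) (comparison g)"
proof (rule extensionalityI[where A="Obj (slice_hom s A g e)"])
  fix k assume "k \<in> Obj (slice_hom s A g e)"
  then have k: "slice_1cell s A g e k" by simp
  note h = slice_2cellD(1)[OF r] and h' = slice_2cellD(2)[OF r]
  have 1: "rwhisk (fst g') l (functor_comp (fst g') (fst k) F) =
      rwhisk (fst g') (rwhisk (fst g) l (fst k)) F" if "is_functor (fst g') (fst g) F" for F
    by (rule extensionalityI[where A="Obj (fst g')"]) (simp_all add: functor_Obj[OF that])
  have 2: "lwhisk (fst g') (fst u) (lwhisk (fst g') (fst k) \<rho>) =
      lwhisk (fst g') (functor_comp (fst g) (fst u) (fst k)) \<rho>"
    by (rule extensionalityI[where A="Obj (fst g')"])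
      (simp_all add: homD(1)[OF nat_trans_hom[OF slice_2cellD(3)[OF r]]])
  show "lwhisk (slice_hom s A g e) (comparison g') (hom_pre2 s A g' g e h h' \<rho>) k =
      rwhisk (slice_hom s A g e) (mod_pre2 s A g' g c t \<eta> \<mu> h h' \<rho>) (comparison g) k"
    using k slice_2cell_lwhisk[OF k r] is_module_precomp[OF module k]
    by (simp add: hom_pre2_def mod_pre2_def mod_pre_obj_def slice_comp_assoc[OF h k u_1cell]
        slice_comp_assoc[OF h' k u_1cell] 1[OF slice_1cellD(3)[OF h]] 1[OF slice_1cellD(3)[OF h']] 2)
qed simp_all

text \<open>Functoriality and 2-naturality of the comparison hold for every module, so only its
  bijectivity on arrows depends on the choice of \<open>(u, l)\<close>.\<close>

lemma is_EM_object_if_comparison_bij: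
  assumes "\<And>g :: ('g, 'h, 'a, 'f) slice_obj. is_slice_obj A g \<Longrightarrow>
     bij_betw (farr (comparison g)) (Arr (slice_hom s A g e)) (Arr (Modules g))"
  shows "is_EM_object TYPE('g \<times> 'h) TYPE('k \<times> 'l) s A c t \<eta> \<mu> e u l"
  unfolding is_EM_object_def
  using slice_monad module slice_1cell_sliceD(1)[OF u_1cell] assms
    cat_isomorphism_if_bij_on_arrows[OF is_functor_comparison] comparison_natural comparison_natural2
  by blast

end

section \<open>The monad on the product category\<close>

lemma prod_cat_simps [simp]:
  "Obj (prod_cat C D) = Obj C \<times> Obj D"
  "Arr (prod_cat C D) = Arr C \<times> Arr D"
  "Dom (prod_cat C D) (f, g) = (Dom C f, Dom D g)"
  "Cod (prod_cat C D) (f, g) = (Cod C f, Cod D g)"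
  "Id (prod_cat C D) (a, x) = (Id C a, Id D x)"
  "Comp (prod_cat C D) (f', g') (f, g) = (Comp C f' f, Comp D g' g)"
  by (simp_all add: prod_cat_def)

lemma hom_prod_cat [simp]:
  "(f, g) \<in> hom (prod_cat C D) (a, x) (b, y) \<longleftrightarrow> f \<in> hom C a b \<and> g \<in> hom D x y"
  by (auto simp: hom_def)

lemma category_prod_cat: "category C \<Longrightarrow> category D \<Longrightarrow> category (prod_cat C D)"
  unfolding category_def hom_def prod_cat_def by auto

lemma proj1_simps [simp]:
  "a \<in> Obj C \<Longrightarrow> x \<in> Obj D \<Longrightarrow> fobj (proj1 C D) (a, x) = a"
  "f \<in> Arr C \<Longrightarrow> g \<in> Arr D \<Longrightarrow> farr (proj1 C D) (f, g) = f"
  by (simp_all add: proj1_def)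

lemma is_functor_proj1:
  assumes C: "category C" and D: "category D"
  shows "is_functor (prod_cat C D) C (proj1 C D)"
proof (rule is_functorI)
  show "fobj (proj1 C D) \<in> extensional (Obj (prod_cat C D))"
    "farr (proj1 C D) \<in> extensional (Arr (prod_cat C D))"
    by (simp_all add: proj1_def)
  show "farr (proj1 C D) h \<in> hom C (fobj (proj1 C D) p) (fobj (proj1 C D) q)"
    if h: "h \<in> hom (prod_cat C D) p q" for h p q
  proof -
    obtain f g a x b y where [simp]: "h = (f, g)" "p = (a, x)" "q = (b, y)" by (cases h, cases p, cases q)
    have *: "f \<in> hom C a b" "g \<in> hom D x y" using h by simp_all
    then show ?thesis by (simp add: homD(1) hom_ObjD[OF C *(1)] hom_ObjD[OF D *(2)])
  qed
  show "farr (proj1 C D) (Comp (prod_cat C D) k h) = Comp C (farr (proj1 C D) k) (farr (proj1 C D) h)"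
    if h: "h \<in> hom (prod_cat C D) p q" and k: "k \<in> hom (prod_cat C D) q r" for h k p q r
    using homD(1)[OF Comp_in_hom[OF category_prod_cat[OF C D] h k]] homD(1)[OF h] homD(1)[OF k]
    by (cases h, cases k) simp
qed (auto simp: category_prod_cat C D homD(1)[OF Id_in_hom])

locale parametrized_monad_on =
  fixes A :: "('a, 'f) cat" and X :: "('x, 'm) cat" and T :: "('a, 'f, 'x, 'm) param_monad"
  assumes A: "category A" and X: "category X" and param: "parametrized_monad A X T"
begin

abbreviation End where "End a \<equiv> mfun (fobj T a)"
abbreviation unit_at where "unit_at a \<equiv> munit (fobj T a)"
abbreviation mult_at where "mult_at a \<equiv> mmult (fobj T a)"
abbreviation trans_at where "trans_at f \<equiv> fst (snd (farr T f))"
abbreviation AX where "AX \<equiv> prod_cat A X"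

lemmas AX = category_prod_cat[OF A X]
lemmas AX_extensional [simp] = transformation_extensional[where C = AX, simplified prod_cat_simps]

lemma T_functor: "is_functor A (Mnd X) T"
  using param by (simp add: parametrized_monad_def)

lemma is_monad_at: "a \<in> Obj A \<Longrightarrow> is_monad X (fobj T a)"
  using functor_Obj[OF T_functor] by (simp add: Mnd_def)

lemma is_functor_End: "a \<in> Obj A \<Longrightarrow> is_functor X X (End a)"
  using is_monad_at[of a] by (simp add: is_monad_def Let_def)

lemma End_hom: "a \<in> Obj A \<Longrightarrow> g \<in> hom X x y \<Longrightarrow> farr (End a) g \<in> hom X (fobj (End a) x) (fobj (End a) y)"
  by (rule functor_hom[OF is_functor_End])

lemma End_Obj: "a \<in> Obj A \<Longrightarrow> x \<in> Obj X \<Longrightarrow> fobj (End a) x \<in> Obj X"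
  by (rule functor_Obj[OF is_functor_End])

lemma unit_at_trans: "a \<in> Obj A \<Longrightarrow> nat_trans X X (functor_id X) (End a) (unit_at a)"
  and mult_at_trans: "a \<in> Obj A \<Longrightarrow> nat_trans X X (functor_comp X (End a) (End a)) (End a) (mult_at a)"
  using is_monad_at[of a] by (simp_all add: is_monad_def Let_def)

lemma unit_at_hom: "a \<in> Obj A \<Longrightarrow> x \<in> Obj X \<Longrightarrow> unit_at a x \<in> hom X x (fobj (End a) x)"
  using nat_trans_hom[OF unit_at_trans, of a x] by simp

lemma mult_at_hom:
  "a \<in> Obj A \<Longrightarrow> x \<in> Obj X \<Longrightarrow> mult_at a x \<in> hom X (fobj (End a) (fobj (End a) x)) (fobj (End a) x)"
  using nat_trans_hom[OF mult_at_trans, of a x] by simp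

lemma unit_at_natural:
  "a \<in> Obj A \<Longrightarrow> g \<in> hom X x y \<Longrightarrow> Comp X (farr (End a) g) (unit_at a x) = Comp X (unit_at a y) g"
  using nat_trans_natural[OF unit_at_trans, of a g x y] homD(1)[of g X x y] by simp

lemma mult_at_natural:
  "a \<in> Obj A \<Longrightarrow> g \<in> hom X x y \<Longrightarrow>
     Comp X (farr (End a) g) (mult_at a x) = Comp X (mult_at a y) (farr (End a) (farr (End a) g))"
  using nat_trans_natural[OF mult_at_trans, of a g x y] homD(1)[of g X x y] by simp

lemma monad_laws_at:
  assumes a: "a \<in> Obj A" and x: "x \<in> Obj X"
  shows "Comp X (mult_at a x) (unit_at a (fobj (End a) x)) = Id X (fobj (End a) x)"
    and "Comp X (mult_at a x) (farr (End a) (unit_at a x)) = Id X (fobj (End a) x)"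
    and "Comp X (mult_at a x) (mult_at a (fobj (End a) x)) = Comp X (mult_at a x) (farr (End a) (mult_at a x))"
proof -
  have
    1: "vcomp X X (mult_at a) (rwhisk X (unit_at a) (End a)) = nat_id X X (End a)" and
    2: "vcomp X X (mult_at a) (lwhisk X (End a) (unit_at a)) = nat_id X X (End a)" and
    3: "vcomp X X (mult_at a) (rwhisk X (mult_at a) (End a)) =
        vcomp X X (mult_at a) (lwhisk X (End a) (mult_at a))"
    using is_monad_at[OF a] by (simp_all add: is_monad_def Let_def)
  show "Comp X (mult_at a x) (unit_at a (fobj (End a) x)) = Id X (fobj (End a) x)"
    using fun_cong[OF 1, of x] x by simp
  show "Comp X (mult_at a x) (farr (End a) (unit_at a x)) = Id X (fobj (End a) x)"
    using fun_cong[OF 2, of x] x by simp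
  show "Comp X (mult_at a x) (mult_at a (fobj (End a) x)) = Comp X (mult_at a x) (farr (End a) (mult_at a x))"
    using fun_cong[OF 3, of x] x by simp
qed

lemma farr_T:
  assumes f: "f \<in> hom A a b"
  shows "farr T f = (fobj T a, trans_at f, fobj T b)"
    and "monad_morphism X (fobj T a) (fobj T b) (trans_at f)"
proof -
  have 1: "farr T f \<in> hom (Mnd X) (fobj T a) (fobj T b)"
    by (rule functor_hom[OF T_functor f])
  then show "farr T f = (fobj T a, trans_at f, fobj T b)"
    by (cases "farr T f") (simp add: hom_def Mnd_def)
  with 1 show "monad_morphism X (fobj T a) (fobj T b) (trans_at f)"
    by (cases "farr T f") (simp add: hom_def Mnd_def)
qed

lemma trans_at_trans: "f \<in> hom A a b \<Longrightarrow> nat_trans X X (End a) (End b) (trans_at f)"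
  using farr_T(2) by (simp add: monad_morphism_def)

lemma trans_at_hom:
  "f \<in> hom A a b \<Longrightarrow> x \<in> Obj X \<Longrightarrow> trans_at f x \<in> hom X (fobj (End a) x) (fobj (End b) x)"
  by (rule nat_trans_hom[OF trans_at_trans])

lemma trans_at_unit:
  assumes f: "f \<in> hom A a b" and x: "x \<in> Obj X"
  shows "Comp X (trans_at f x) (unit_at a x) = unit_at b x"
proof -
  have "vcomp X X (trans_at f) (unit_at a) = unit_at b"
    using farr_T(2)[OF f] by (simp add: monad_morphism_def)
  from fun_cong[OF this, of x] show ?thesis using x by simp
qed

lemma trans_at_mult:
  assumes f: "f \<in> hom A a b" and x: "x \<in> Obj X"
  shows "Comp X (trans_at f x) (mult_at a x) =
    Comp X (mult_at b x) (Comp X (trans_at f (fobj (End b) x)) (farr (End a) (trans_at f x)))"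
proof -
  have "vcomp X X (trans_at f) (mult_at a) =
      vcomp X X (mult_at b) (vcomp X X (rwhisk X (trans_at f) (End b)) (lwhisk X (End a) (trans_at f)))"
    using farr_T(2)[OF f] by (simp add: monad_morphism_def)
  from fun_cong[OF this, of x] show ?thesis using x by simp
qed

lemma trans_at_Id: "a \<in> Obj A \<Longrightarrow> x \<in> Obj X \<Longrightarrow> trans_at (Id A a) x = Id X (fobj (End a) x)"
  by (simp add: functor_Id[OF T_functor]) (simp add: Mnd_def)

lemma trans_at_Comp:
  assumes f: "f \<in> hom A a b" and f': "f' \<in> hom A b c" and x: "x \<in> Obj X"
  shows "trans_at (Comp A f' f) x = Comp X (trans_at f' x) (trans_at f x)"
proof -
  have "farr T (Comp A f' f) = Comp (Mnd X) (farr T f') (farr T f)"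
    by (rule functor_Comp[OF T_functor f f'])
  also have "\<dots> = (fobj T a, vcomp X X (trans_at f') (trans_at f), fobj T c)"
    by (subst farr_T(1)[OF f], subst farr_T(1)[OF f']) (simp add: Mnd_def)
  finally show ?thesis using x by simp
qed

abbreviation Tmap where "Tmap \<equiv> pm_map A X T"

lemma pm_map_eq:
  "f \<in> hom A a b \<Longrightarrow> g \<in> hom X x y \<Longrightarrow> Tmap f g = Comp X (trans_at f y) (farr (End a) g)"
  by (simp add: pm_map_def homD)

lemma pm_map_hom:
  assumes f: "f \<in> hom A a b" and g: "g \<in> hom X x y"
  shows "Tmap f g \<in> hom X (fobj (End a) x) (fobj (End b) y)"
  using Comp_in_hom[OF X End_hom[OF hom_ObjD(1)[OF A f] g] trans_at_hom[OF f hom_ObjD(2)[OF X g]]]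
  by (simp add: pm_map_eq[OF f g])

lemma pm_map_Id_left:
  assumes a: "a \<in> Obj A" and g: "g \<in> hom X x y"
  shows "Tmap (Id A a) g = farr (End a) g"
  using Comp_Id_left[OF X End_hom[OF a g]] trans_at_Id[OF a hom_ObjD(2)[OF X g]]
  by (simp add: pm_map_eq[OF Id_in_hom[OF A a] g])

lemma pm_map_Id:
  assumes a: "a \<in> Obj A" and x: "x \<in> Obj X"
  shows "Tmap (Id A a) (Id X x) = Id X (fobj (End a) x)"
  using functor_Id[OF is_functor_End[OF a] x] by (simp add: pm_map_Id_left[OF a Id_in_hom[OF X x]])

text \<open>Functoriality of \<open>(f, g) \<mapsto> T(f, g)\<close>: naturality of \<open>T\<^sub>f\<close> at \<open>g'\<close> exchanges the two middle factors of
  \<open>T\<^sub>f\<^sub>' \<circ> T\<^sub>f \<circ> T\<^sub>a g' \<circ> T\<^sub>a g\<close>.\<close>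

lemma pm_map_Comp:
  assumes f: "f \<in> hom A a b" and f': "f' \<in> hom A b c" and g: "g \<in> hom X x y" and g': "g' \<in> hom X y z"
  shows "Tmap (Comp A f' f) (Comp X g' g) = Comp X (Tmap f' g') (Tmap f g)"
proof -
  note a = hom_ObjD(1)[OF A f] and b = hom_ObjD(1)[OF A f']
    and y = hom_ObjD(1)[OF X g'] and z = hom_ObjD(2)[OF X g']
  note g1 = End_hom[OF a g] and g2 = End_hom[OF a g'] and g3 = End_hom[OF b g']
    and t1 = trans_at_hom[OF f z] and t2 = trans_at_hom[OF f' z] and t0 = trans_at_hom[OF f y]
  have "Tmap (Comp A f' f) (Comp X g' g) =
      Comp X (Comp X (trans_at f' z) (trans_at f z)) (Comp X (farr (End a) g') (farr (End a) g))"
    using pm_map_eq[OF Comp_in_hom[OF A f f'] Comp_in_hom[OF X g g']] trans_at_Comp[OF f f' z]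
      functor_Comp[OF is_functor_End[OF a] g g'] by simp
  also have "\<dots> = Comp X (Comp X (Comp X (trans_at f' z) (trans_at f z)) (farr (End a) g')) (farr (End a) g)"
    by (rule Comp_assoc[OF X g1 g2 Comp_in_hom[OF X t1 t2]])
  also have "Comp X (Comp X (trans_at f' z) (trans_at f z)) (farr (End a) g') =
      Comp X (trans_at f' z) (Comp X (trans_at f z) (farr (End a) g'))"
    by (rule Comp_assoc[OF X g2 t1 t2, symmetric])
  also have "Comp X (trans_at f z) (farr (End a) g') = Comp X (farr (End b) g') (trans_at f y)"
    by (rule nat_trans_natural[OF trans_at_trans[OF f] g'])
  also have "Comp X (trans_at f' z) (Comp X (farr (End b) g') (trans_at f y)) =
      Comp X (Tmap f' g') (trans_at f y)"
    using Comp_assoc[OF X t0 g3 t2] by (simp add: pm_map_eq[OF f' g'])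
  also have "Comp X (Comp X (Tmap f' g') (trans_at f y)) (farr (End a) g) = Comp X (Tmap f' g') (Tmap f g)"
    using Comp_assoc[OF X g1 t0 pm_map_hom[OF f' g']] by (simp add: pm_map_eq[OF f g])
  finally show ?thesis .
qed

text \<open>Naturality of the unit of \<open>That\<close>, from naturality of \<open>\<eta>\<^sub>a\<close> and preservation of units by \<open>T\<^sub>f\<close>.\<close>

lemma pm_map_unit:
  assumes f: "f \<in> hom A a b" and g: "g \<in> hom X x y"
  shows "Comp X (unit_at b y) g = Comp X (Tmap f g) (unit_at a x)"
proof -
  note a = hom_ObjD(1)[OF A f] and x = hom_ObjD(1)[OF X g] and y = hom_ObjD(2)[OF X g]
  have "Comp X (Tmap f g) (unit_at a x) = Comp X (trans_at f y) (Comp X (farr (End a) g) (unit_at a x))"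
    using Comp_assoc[OF X unit_at_hom[OF a x] End_hom[OF a g] trans_at_hom[OF f y]]
    by (simp add: pm_map_eq[OF f g])
  also have "\<dots> = Comp X (trans_at f y) (Comp X (unit_at a y) g)"
    by (simp add: unit_at_natural[OF a g])
  also have "\<dots> = Comp X (unit_at b y) g"
    using Comp_assoc[OF X g unit_at_hom[OF a y] trans_at_hom[OF f y]] trans_at_unit[OF f y] by simp
  finally show ?thesis by simp
qed

text \<open>Naturality of the multiplication of \<open>That\<close>. Both factors \<open>T\<^sub>f\<close> of \<open>T(f, T(f, g))\<close> are collected on the
  left, where preservation of multiplications turns \<open>\<mu>\<^sub>b\<close> into \<open>\<mu>\<^sub>a\<close>; then \<open>\<mu>\<^sub>a\<close> moves past \<open>g\<close>.\<close>

lemma pm_map_mult: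
  assumes f: "f \<in> hom A a b" and g: "g \<in> hom X x y"
  shows "Comp X (mult_at b y) (Tmap f (Tmap f g)) = Comp X (Tmap f g) (mult_at a x)"
proof -
  note a = hom_ObjD(1)[OF A f] and b = hom_ObjD(2)[OF A f]
    and x = hom_ObjD(1)[OF X g] and y = hom_ObjD(2)[OF X g]
  note t = trans_at_hom[OF f y] and Eg = End_hom[OF a g]
  note Et = End_hom[OF a t] and EEg = End_hom[OF a Eg] and t' = trans_at_hom[OF f End_Obj[OF b y]]
  have "Tmap f (Tmap f g) =
      Comp X (trans_at f (fobj (End b) y)) (Comp X (farr (End a) (trans_at f y)) (farr (End a) (farr (End a) g)))"
    using pm_map_eq[OF f pm_map_hom[OF f g]] functor_Comp[OF is_functor_End[OF a] Eg t]
    by (simp add: pm_map_eq[OF f g])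
  also have "\<dots> =
      Comp X (Comp X (trans_at f (fobj (End b) y)) (farr (End a) (trans_at f y))) (farr (End a) (farr (End a) g))"
    by (rule Comp_assoc[OF X EEg Et t'])
  finally have "Comp X (mult_at b y) (Tmap f (Tmap f g)) =
      Comp X (Comp X (mult_at b y) (Comp X (trans_at f (fobj (End b) y)) (farr (End a) (trans_at f y))))
        (farr (End a) (farr (End a) g))"
    using Comp_assoc[OF X EEg Comp_in_hom[OF X Et t'] mult_at_hom[OF b y]] by simp
  also have "\<dots> = Comp X (Comp X (trans_at f y) (mult_at a y)) (farr (End a) (farr (End a) g))"
    by (simp add: trans_at_mult[OF f y])
  also have "\<dots> = Comp X (trans_at f y) (Comp X (farr (End a) g) (mult_at a x))"
    using Comp_assoc[OF X EEg mult_at_hom[OF a y] t] mult_at_natural[OF a g] by simp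
  also have "\<dots> = Comp X (Tmap f g) (mult_at a x)"
    using Comp_assoc[OF X mult_at_hom[OF a x] Eg t] by (simp add: pm_map_eq[OF f g])
  finally show ?thesis .
qed

abbreviation That_fun where "That_fun \<equiv> mfun (That A X T)"
abbreviation That_unit where "That_unit \<equiv> munit (That A X T)"
abbreviation That_mult where "That_mult \<equiv> mmult (That A X T)"

lemma That_simps [simp]:
  "a \<in> Obj A \<Longrightarrow> x \<in> Obj X \<Longrightarrow> fobj That_fun (a, x) = (a, fobj (End a) x)"
  "f \<in> Arr A \<Longrightarrow> g \<in> Arr X \<Longrightarrow> farr That_fun (f, g) = (f, Tmap f g)"
  "a \<in> Obj A \<Longrightarrow> x \<in> Obj X \<Longrightarrow> That_unit (a, x) = (Id A a, unit_at a x)"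
  "a \<in> Obj A \<Longrightarrow> x \<in> Obj X \<Longrightarrow> That_mult (a, x) = (Id A a, mult_at a x)"
  by (simp_all add: That_def)

lemma That_extensional [simp]:
  "fobj That_fun \<in> extensional (Obj A \<times> Obj X)"
  "farr That_fun \<in> extensional (Arr A \<times> Arr X)"
  "That_unit \<in> extensional (Obj A \<times> Obj X)"
  "That_mult \<in> extensional (Obj A \<times> Obj X)"
  by (simp_all add: That_def)

lemma is_functor_That: "is_functor AX AX That_fun"
proof (rule is_functorI[OF AX AX])
  show "fobj That_fun p \<in> Obj AX" if "p \<in> Obj AX" for p
    using that by (cases p) (simp add: End_Obj)
  show "farr That_fun h \<in> hom AX (fobj That_fun p) (fobj That_fun q)" if h: "h \<in> hom AX p q" for h p q
  proof -
    obtain f g a x b y where [simp]: "h = (f, g)" "p = (a, x)" "q = (b, y)" by (cases h, cases p, cases q)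
    have "f \<in> hom A a b" "g \<in> hom X x y" using h by simp_all
    then show ?thesis by (simp add: homD(1) hom_ObjD[OF A] hom_ObjD[OF X] pm_map_hom)
  qed
  show "farr That_fun (Id AX p) = Id AX (fobj That_fun p)" if "p \<in> Obj AX" for p
    using that by (cases p) (simp add: pm_map_Id homD(1)[OF Id_in_hom[OF A]] homD(1)[OF Id_in_hom[OF X]])
  show "farr That_fun (Comp AX k h) = Comp AX (farr That_fun k) (farr That_fun h)"
    if h: "h \<in> hom AX p q" and k: "k \<in> hom AX q r" for h k p q r
  proof -
    obtain f g f' g' a x b y c z where [simp]: "h = (f, g)" "k = (f', g')" "p = (a, x)" "q = (b, y)" "r = (c, z)"
      by (cases h, cases k, cases p, cases q, cases r)
    have *: "f \<in> hom A a b" "f' \<in> hom A b c" "g \<in> hom X x y" "g' \<in> hom X y z" using h k by simp_all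
    then show ?thesis
      using Comp_in_hom[OF A *(1,2)] Comp_in_hom[OF X *(3,4)] by (simp add: homD(1) pm_map_Comp[OF *])
  qed
qed simp_all

lemma That_unit_trans: "nat_trans AX AX (functor_id AX) That_fun That_unit"
proof (rule nat_transI[OF is_functor_id[OF AX] is_functor_That])
  show "That_unit p \<in> hom AX (fobj (functor_id AX) p) (fobj That_fun p)" if "p \<in> Obj AX" for p
    using that by (cases p) (simp add: Id_in_hom[OF A] unit_at_hom)
  show "Comp AX (That_unit q) (farr (functor_id AX) h) = Comp AX (farr That_fun h) (That_unit p)"
    if h: "h \<in> hom AX p q" for h p q
  proof -
    obtain f g a x b y where [simp]: "h = (f, g)" "p = (a, x)" "q = (b, y)" by (cases h, cases p, cases q)
    have *: "f \<in> hom A a b" "g \<in> hom X x y" using h by simp_all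
    then show ?thesis
      by (simp add: homD(1) hom_ObjD[OF A *(1)] hom_ObjD[OF X *(2)] pm_map_unit
          Comp_Id_left[OF A *(1)] Comp_Id_right[OF A *(1)])
  qed
qed simp

lemma That_mult_trans: "nat_trans AX AX (functor_comp AX That_fun That_fun) That_fun That_mult"
proof (rule nat_transI[OF is_functor_comp[OF is_functor_That is_functor_That] is_functor_That])
  show "That_mult p \<in> hom AX (fobj (functor_comp AX That_fun That_fun) p) (fobj That_fun p)"
    if "p \<in> Obj AX" for p
    using that by (cases p) (simp add: Id_in_hom[OF A] mult_at_hom End_Obj)
  show "Comp AX (That_mult q) (farr (functor_comp AX That_fun That_fun) h) =
      Comp AX (farr That_fun h) (That_mult p)"
    if h: "h \<in> hom AX p q" for h p q
  proof -
    obtain f g a x b y where [simp]: "h = (f, g)" "p = (a, x)" "q = (b, y)" by (cases h, cases p, cases q)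
    have *: "f \<in> hom A a b" "g \<in> hom X x y" using h by simp_all
    then show ?thesis
      by (simp add: homD(1) hom_ObjD[OF A *(1)] hom_ObjD[OF X *(2)] pm_map_mult
          homD(1)[OF pm_map_hom] Comp_Id_left[OF A *(1)] Comp_Id_right[OF A *(1)])
  qed
qed simp

abbreviation base where "base \<equiv> (prod_cat A X, proj1 A X)"
abbreviation That_cell where "That_cell \<equiv> (That_fun, nat_id AX A (proj1 A X))"

lemma is_slice_obj_base: "is_slice_obj A base"
  by (simp add: is_slice_obj_def is_functor_proj1 A X)

lemma proj1_That: "functor_comp AX (proj1 A X) That_fun = proj1 A X"
proof (rule functor_eqI[OF is_functor_comp[OF is_functor_That is_functor_proj1[OF A X]] is_functor_proj1[OF A X]])
  show "fobj (functor_comp AX (proj1 A X) That_fun) p = fobj (proj1 A X) p" if "p \<in> Obj AX" for p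
    using that by (cases p) (simp add: End_Obj)
  show "farr (functor_comp AX (proj1 A X) That_fun) h = farr (proj1 A X) h" if "h \<in> Arr AX" for h
    using that by (cases h) (simp add: homD(1)[OF pm_map_hom[OF arr_in_hom arr_in_hom]])
qed

lemma slice_monad_That: "slice_monad s A base That_cell That_unit That_mult"
proof -
  have cell: "slice_1cell s A base base That_cell"
    using slice_1cell_if_triangle_commutes[OF is_slice_obj_base is_slice_obj_base, of That_fun s]
    by (simp add: is_functor_That proj1_That)
  have "slice_2cell s A base base (slice_id A base) That_cell That_unit"
  proof (rule slice_2cellI[OF slice_1cell_id[OF is_slice_obj_base] cell])
    show "vcomp (fst base) A (snd That_cell) (lwhisk (fst base) (snd base) That_unit) = snd (slice_id A base)"
      by (rule extensionalityI[where A="Obj AX"])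
        (auto simp: slice_id_def Id_in_hom[OF A] homD(1)[OF Id_in_hom[OF A]]
          homD(1)[OF unit_at_hom] Comp_Id_left[OF A Id_in_hom[OF A]])
  qed (simp add: slice_id_def That_unit_trans)
  moreover have "slice_2cell s A base base (slice_comp A base That_cell That_cell) That_cell That_mult"
  proof (rule slice_2cellI[OF slice_1cell_comp[OF cell cell] cell])
    show "vcomp (fst base) A (snd That_cell) (lwhisk (fst base) (snd base) That_mult) =
        snd (slice_comp A base That_cell That_cell)"
      by (rule extensionalityI[where A="Obj AX"])
        (auto simp: Id_in_hom[OF A] homD(1)[OF Id_in_hom[OF A]] End_Obj
          homD(1)[OF mult_at_hom] Comp_Id_left[OF A Id_in_hom[OF A]])
  qed (simp add: That_mult_trans)
  moreover have "vcomp AX AX That_mult (rwhisk AX That_unit That_fun) = nat_id AX AX That_fun"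
    by (rule extensionalityI[where A="Obj AX"])
      (auto simp: End_Obj monad_laws_at Comp_Id_left[OF A Id_in_hom[OF A]])
  moreover have "vcomp AX AX That_mult (lwhisk AX That_fun That_unit) = nat_id AX AX That_fun"
    by (rule extensionalityI[where A="Obj AX"])
      (auto simp: monad_laws_at Comp_Id_left[OF A Id_in_hom[OF A]] pm_map_Id_left[OF _ unit_at_hom]
        homD(1)[OF unit_at_hom] homD(1)[OF Id_in_hom[OF A]])
  moreover have "vcomp AX AX That_mult (rwhisk AX That_mult That_fun) =
      vcomp AX AX That_mult (lwhisk AX That_fun That_mult)"
    by (rule extensionalityI[where A="Obj AX"])
      (auto simp: End_Obj monad_laws_at Comp_Id_left[OF A Id_in_hom[OF A]] pm_map_Id_left[OF _ mult_at_hom]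
        homD(1)[OF mult_at_hom] homD(1)[OF Id_in_hom[OF A]])
  ultimately show ?thesis
    using cell by (simp add: slice_monad_def Let_def)
qed

end

section \<open>The category of algebras of a parametrized monad\<close>

context parametrized_monad_on
begin

abbreviation alg where "alg a x \<xi> \<equiv> EM_algebra X (fobj T a) x \<xi>"
abbreviation L where "L \<equiv> ltimes A X T"
abbreviation L_proj where "L_proj \<equiv> ltimes_proj A X T"
abbreviation L_forget where "L_forget \<equiv> ltimes_forget A X T"
abbreviation L_action where "L_action \<equiv> ltimes_action A X T"

lemma algD:
  assumes "alg a x \<xi>"
  shows "x \<in> Obj X" "\<xi> \<in> hom X (fobj (End a) x) x" "Comp X \<xi> (unit_at a x) = Id X x"
    "Comp X \<xi> (mult_at a x) = Comp X \<xi> (farr (End a) \<xi>)"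
  using assms by (auto simp: EM_algebra_def)

lemma ltimes_simps [simp]:
  "(a, x, \<xi>) \<in> Obj L \<longleftrightarrow> a \<in> Obj A \<and> alg a x \<xi>"
  "((a, x, \<xi>), (f, g), (b, y, \<theta>)) \<in> Arr L \<longleftrightarrow>
     a \<in> Obj A \<and> alg a x \<xi> \<and> b \<in> Obj A \<and> alg b y \<theta> \<and> f \<in> hom A a b \<and> g \<in> hom X x y \<and>
     Comp X g \<xi> = Comp X \<theta> (Tmap f g)"
  "Dom L (p, h, q) = p"
  "Cod L (p, h, q) = q"
  "Id L (a, x, \<xi>) = ((a, x, \<xi>), (Id A a, Id X x), (a, x, \<xi>))"
  "Comp L (q, (f', g'), r) (p, (f, g), q') = (p, (Comp A f' f, Comp X g' g), r)"
  by (simp_all add: ltimes_def)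

lemma ltimes_ArrE:
  assumes "h \<in> Arr L"
  obtains a x \<xi> f g b y \<theta> where "h = ((a, x, \<xi>), (f, g), (b, y, \<theta>))"
    "a \<in> Obj A" "alg a x \<xi>" "b \<in> Obj A" "alg b y \<theta>" "f \<in> hom A a b" "g \<in> hom X x y"
    "Comp X g \<xi> = Comp X \<theta> (Tmap f g)"
  using assms unfolding ltimes_def by auto

lemma ltimes_homE:
  assumes "h \<in> hom L p q"
  obtains a x \<xi> f g b y \<theta> where
    "p = (a, x, \<xi>)" "q = (b, y, \<theta>)" "h = ((a, x, \<xi>), (f, g), (b, y, \<theta>))"
    "a \<in> Obj A" "alg a x \<xi>" "b \<in> Obj A" "alg b y \<theta>" "f \<in> hom A a b" "g \<in> hom X x y"
    "Comp X g \<xi> = Comp X \<theta> (Tmap f g)"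
  using assms homD[OF assms] by (auto elim!: ltimes_ArrE)

lemma ltimes_Id_in_Arr:
  assumes a: "a \<in> Obj A" and x: "alg a x \<xi>"
  shows "((a, x, \<xi>), (Id A a, Id X x), (a, x, \<xi>)) \<in> Arr L"
  using assms algD[OF x] Comp_Id_left[OF X algD(2)[OF x]] Comp_Id_right[OF X algD(2)[OF x]]
  by (simp add: Id_in_hom A X pm_map_Id)

lemma ltimes_Comp_in_Arr:
  assumes h: "((a, x, \<xi>), (f, g), (b, y, \<theta>)) \<in> Arr L"
    and k: "((b, y, \<theta>), (f', g'), (c, z, \<zeta>)) \<in> Arr L"
  shows "((a, x, \<xi>), (Comp A f' f, Comp X g' g), (c, z, \<zeta>)) \<in> Arr L"
proof -
  have *: "f \<in> hom A a b" "f' \<in> hom A b c" "g \<in> hom X x y" "g' \<in> hom X y z"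
    "Comp X g \<xi> = Comp X \<theta> (Tmap f g)" "Comp X g' \<theta> = Comp X \<zeta> (Tmap f' g')"
    and \<xi>: "\<xi> \<in> hom X (fobj (End a) x) x" and \<theta>: "\<theta> \<in> hom X (fobj (End b) y) y"
    and \<zeta>: "\<zeta> \<in> hom X (fobj (End c) z) z"
    using h k by (auto dest: algD(2))
  have "Comp X (Comp X g' g) \<xi> = Comp X (Comp X g' \<theta>) (Tmap f g)"
    using Comp_assoc[OF X \<xi> *(3,4)] Comp_assoc[OF X pm_map_hom[OF *(1,3)] \<theta> *(4)] *(5) by simp
  also have "\<dots> = Comp X \<zeta> (Comp X (Tmap f' g') (Tmap f g))"
    using Comp_assoc[OF X pm_map_hom[OF *(1,3)] pm_map_hom[OF *(2,4)] \<zeta>] *(6) by simp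
  finally show ?thesis
    using h k Comp_in_hom[OF A *(1,2)] Comp_in_hom[OF X *(3,4)] pm_map_Comp[OF *(1-4)] by simp
qed

lemma category_ltimes: "category L"
proof (rule categoryI)
  fix h assume "h \<in> Arr L"
  then show "Dom L h \<in> Obj L" "Cod L h \<in> Obj L"
    by (auto elim!: ltimes_ArrE)
  from \<open>h \<in> Arr L\<close> show "Comp L h (Id L (Dom L h)) = h" "Comp L (Id L (Cod L h)) h = h"
    by (auto elim!: ltimes_ArrE simp: Comp_Id_left[OF A] Comp_Id_right[OF A] Comp_Id_left[OF X] Comp_Id_right[OF X])
  fix k assume "k \<in> Arr L" "Dom L k = Cod L h"
  with \<open>h \<in> Arr L\<close> show "Comp L k h \<in> hom L (Dom L h) (Cod L k)"
    by (auto elim!: ltimes_ArrE intro!: homI ltimes_Comp_in_Arr simp del: ltimes_simps(2)) auto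
  fix j assume "j \<in> Arr L" "Dom L j = Cod L k"
  with \<open>h \<in> Arr L\<close> \<open>k \<in> Arr L\<close> \<open>Dom L k = Cod L h\<close>
  show "Comp L j (Comp L k h) = Comp L (Comp L j k) h"
    by (auto elim!: ltimes_ArrE intro: Comp_assoc[OF A] Comp_assoc[OF X])
next
  fix p assume "p \<in> Obj L"
  then show "Id L p \<in> hom L p p"
    using ltimes_Id_in_Arr by (cases p) (auto intro!: homI simp del: ltimes_simps(2))
qed

lemma ltimes_functors_simps [simp]:
  "(a, x, \<xi>) \<in> Obj L \<Longrightarrow> fobj L_forget (a, x, \<xi>) = (a, x)"
  "(p, h, q) \<in> Arr L \<Longrightarrow> farr L_forget (p, h, q) = h"
  "(a, x, \<xi>) \<in> Obj L \<Longrightarrow> fobj L_proj (a, x, \<xi>) = a"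
  "(p, (f, g), q) \<in> Arr L \<Longrightarrow> farr L_proj (p, (f, g), q) = f"
  "(a, x, \<xi>) \<in> Obj L \<Longrightarrow> L_action (a, x, \<xi>) = (Id A a, \<xi>)"
  by (simp_all add: ltimes_forget_def ltimes_proj_def ltimes_action_def)

lemma is_functor_ltimes_forget: "is_functor L AX L_forget"
proof (rule is_functorI[OF category_ltimes AX])
  show "fobj L_forget \<in> extensional (Obj L)" "farr L_forget \<in> extensional (Arr L)"
    by (simp_all add: ltimes_forget_def)
  show "fobj L_forget p \<in> Obj AX" if "p \<in> Obj L" for p
    using that by (cases p) (auto dest: algD)
  show "farr L_forget h \<in> hom AX (fobj L_forget p) (fobj L_forget q)" if "h \<in> hom L p q" for h p q
    using that by (auto elim!: ltimes_homE)
  show "farr L_forget (Id L p) = Id AX (fobj L_forget p)" if "p \<in> Obj L" for p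
    using that ltimes_Id_in_Arr by (cases p) (auto simp del: ltimes_simps(2))
  show "farr L_forget (Comp L k h) = Comp AX (farr L_forget k) (farr L_forget h)"
    if h: "h \<in> hom L p q" and k: "k \<in> hom L q r" for h k p q r
    using homD(1)[OF h] homD(1)[OF k] homD(1)[OF Comp_in_hom[OF category_ltimes h k]]
    by (cases h, cases k, cases "fst (snd h)", cases "fst (snd k)") (simp del: ltimes_simps(2))
qed

lemma is_functor_ltimes_proj: "is_functor L A L_proj"
  and ltimes_proj_eq: "functor_comp L (proj1 A X) L_forget = L_proj"
proof -
  have "fobj (functor_comp L (proj1 A X) L_forget) = fobj L_proj"
  proof (rule extensionalityI[where A="Obj L"])
    show "fobj (functor_comp L (proj1 A X) L_forget) p = fobj L_proj p" if "p \<in> Obj L" for p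
      using that by (cases p) (auto dest: algD)
  qed (simp_all add: ltimes_proj_def)
  moreover have "farr (functor_comp L (proj1 A X) L_forget) = farr L_proj"
  proof (rule extensionalityI[where A="Arr L"])
    show "farr (functor_comp L (proj1 A X) L_forget) h = farr L_proj h" if "h \<in> Arr L" for h
      using that by (auto elim!: ltimes_ArrE simp: homD(1))
  qed (simp_all add: ltimes_proj_def)
  ultimately show eq: "functor_comp L (proj1 A X) L_forget = L_proj" by simp
  show "is_functor L A L_proj"
    using is_functor_comp[OF is_functor_ltimes_forget is_functor_proj1[OF A X]] eq by simp
qed

text \<open>An algebra is determined by its carrier over \<open>A \<times> X\<close> and its structure map, and a morphism by
  its underlying pair: the forgetful functor together with the action loses nothing.\<close>

lemma ltimes_Obj_eqI:
  assumes "p \<in> Obj L" "q \<in> Obj L" "fobj L_forget p = fobj L_forget q" "L_action p = L_action q"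
  shows "p = q"
  using assms by (cases p, cases q) auto

lemma ltimes_hom_eqI:
  assumes "h \<in> hom L p q" "h' \<in> hom L p q" "farr L_forget h = farr L_forget h'"
  shows "h = h'"
  using assms homD[OF assms(1)] homD[OF assms(2)] by (cases h, cases h') auto

abbreviation over where "over \<equiv> (ltimes A X T, ltimes_proj A X T)"
abbreviation forget_cell where "forget_cell \<equiv> (L_forget, nat_id L A L_proj)"

lemma is_slice_obj_over: "is_slice_obj A over"
  by (simp add: is_slice_obj_def is_functor_ltimes_proj)

lemma forget_1cell: "slice_1cell s A over base forget_cell"
  using slice_1cell_if_triangle_commutes[OF is_slice_obj_over is_slice_obj_base, of L_forget s]
  by (simp add: is_functor_ltimes_forget ltimes_proj_eq)

lemma snd_comp_forget:
  assumes k: "slice_1cell s A g over k"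
  shows "snd (slice_comp A g forget_cell k) = snd k"
  using slice_1cellD(5)[OF k] vcomp_nat_id_right[OF slice_1cellD(5)[OF k]]
  by (simp add: rwhisk_nat_id[OF slice_1cellD(3)[OF k, simplified]])

lemma ltimes_action_trans:
  "nat_trans L AX (functor_comp L That_fun L_forget) L_forget L_action"
proof (rule nat_transI[OF is_functor_comp[OF is_functor_ltimes_forget is_functor_That] is_functor_ltimes_forget])
  show "L_action \<in> extensional (Obj L)" by (simp add: ltimes_action_def)
  show "L_action p \<in> hom AX (fobj (functor_comp L That_fun L_forget) p) (fobj L_forget p)"
    if "p \<in> Obj L" for p
    using that by (cases p) (auto simp: algD Id_in_hom[OF A])
  show "Comp AX (L_action q) (farr (functor_comp L That_fun L_forget) h) =
      Comp AX (farr L_forget h) (L_action p)" if "h \<in> hom L p q" for h p q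
    using that
    by (auto elim!: ltimes_homE simp: homD(1) Comp_Id_left[OF A] Comp_Id_right[OF A])
qed

end

locale parametrized_monad_slice = parametrized_monad_on +
  fixes s :: slice_kind
begin

sublocale That: slice_monad_on s A base That_cell That_unit That_mult
  by unfold_locales (rule slice_monad_That)

lemma ltimes_module: "That.is_module over forget_cell L_action"
proof (rule That.is_moduleI[OF forget_1cell])
  show "slice_2cell s A over base (slice_comp A over That_cell forget_cell) forget_cell L_action"
  proof (rule slice_2cellI[OF slice_1cell_comp[OF forget_1cell That.t_1cell] forget_1cell])
    show "vcomp (fst over) A (snd forget_cell) (lwhisk (fst over) (snd base) L_action) =
        snd (slice_comp A over That_cell forget_cell)"
    proof (rule extensionalityI[where A="Obj L"])
      fix p assume p: "p \<in> Obj L"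
      then obtain a x \<xi> where [simp]: "p = (a, x, \<xi>)" and *: "a \<in> Obj A" "alg a x \<xi>"
        by (cases p) simp
      show "vcomp (fst over) A (snd forget_cell) (lwhisk (fst over) (snd base) L_action) p =
          snd (slice_comp A over That_cell forget_cell) p"
        using * algD(1,2)[OF *(2)] by (simp add: homD(1)[OF Id_in_hom[OF A]] homD(1))
    qed simp_all
  qed (simp add: ltimes_action_trans)
  fix p assume "p \<in> Obj (fst over)"
  then obtain a x \<xi> where [simp]: "p = (a, x, \<xi>)" and *: "a \<in> Obj A" "alg a x \<xi>"
    by (cases p) simp
  show "Comp (fst base) (L_action p) (That_unit (fobj (fst forget_cell) p)) =
      Id (fst base) (fobj (fst forget_cell) p)"
    using * algD[OF *(2)] by (simp add: Comp_Id_left[OF A Id_in_hom[OF A]])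
  show "Comp (fst base) (L_action p) (That_mult (fobj (fst forget_cell) p)) =
      Comp (fst base) (L_action p) (farr (fst That_cell) (L_action p))"
    using * algD[OF *(2)]
    by (simp add: Comp_Id_left[OF A Id_in_hom[OF A]] homD(1)[OF Id_in_hom[OF A]] homD(1)
        pm_map_Id_left[OF _ algD(2)[OF *(2)]])
qed

sublocale That: slice_monad_module s A base That_cell That_unit That_mult over forget_cell L_action
  by unfold_locales (rule ltimes_module)


section \<open>Modules over the monad are functors into the category of algebras\<close>

text \<open>The triangle condition on the action \<open>l\<close> reads \<open>\<phi>\<^sub>x \<circ> fst (l x) = \<phi>\<^sub>x\<close>, and \<open>\<phi>\<^sub>x\<close> is invertible; so
  \<open>l x\<close> lies over an identity of \<open>A\<close>, even when the triangles commute only up to isomorphism. Its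
  other component is an algebra for the monad at the object below.\<close>

lemma module_at:
  assumes m: "That.is_module g m l" and x: "x \<in> Obj (fst g)"
  obtains a y \<xi> where "fobj (fst m) x = (a, y)" "l x = (Id A a, \<xi>)" "a \<in> Obj A" "alg a y \<xi>"
proof -
  note M = That.is_moduleD[OF m]
  note c = slice_1cellD[OF M(1)]
  obtain a y where p: "fobj (fst m) x = (a, y)" by (cases "fobj (fst m) x")
  obtain i \<xi> where l: "l x = (i, \<xi>)" by (cases "l x")
  have ay: "a \<in> Obj A" "y \<in> Obj X"
    using functor_Obj[OF c(3) x] p by simp_all
  have hom: "i \<in> hom A a a" "\<xi> \<in> hom X (fobj (End a) y) y"
    using nat_trans_hom[OF M(3) x] x p l ay by simp_all
  have \<phi>: "snd m x \<in> hom A a (fobj (snd g) x)"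
    using nat_trans_hom[OF c(5) x] x p ay by simp
  have iso: "iso_arrow A (snd m x)"
    using c(4) x by (simp add: nat_iso_def)
  have "Comp A (snd m x) i = Comp A (snd m x) (Id A a)"
    using fun_cong[OF slice_2cellD(4)[OF M(2)], of x] x p l ay hom by (simp add: homD(1))
  then have i: "i = Id A a"
    by (rule iso_arrow_mono[OF A \<phi> iso hom(1) Id_in_hom[OF A ay(1)]])
  have "alg a y \<xi>"
    unfolding EM_algebra_def
    using M(4)[OF x] M(5)[OF x] p l ay hom i
    by (simp add: homD(1)[OF Id_in_hom[OF A]] homD(1) pm_map_Id_left[OF _ hom(2)])
  then show ?thesis using that p l i ay by blast
qed

text \<open>The 1-cell into \<open>A \<ltimes>\<^sup>T X\<close> named by a module. It inherits the isomorphism of its triangle from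
  \<open>m\<close>, because the triangle of the forgetful functor commutes strictly.\<close>

definition lift_obj where
  "lift_obj m l x = (fst (fobj (fst m) x), snd (fobj (fst m) x), snd (l x))"

definition lift where
  "lift g m l = (\<lparr>fobj = (\<lambda>x\<in>Obj (fst g). lift_obj m l x),
     farr = (\<lambda>f\<in>Arr (fst g). (lift_obj m l (Dom (fst g) f), farr (fst m) f, lift_obj m l (Cod (fst g) f)))\<rparr>,
     snd m)"

lemma lift_simps [simp]:
  "x \<in> Obj (fst g) \<Longrightarrow> fobj (fst (lift g m l)) x = lift_obj m l x"
  "f \<in> hom (fst g) x y \<Longrightarrow> farr (fst (lift g m l)) f = (lift_obj m l x, farr (fst m) f, lift_obj m l y)"
  "snd (lift g m l) = snd m"
  by (simp_all add: lift_def homD)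

lemma lift_obj:
  assumes m: "That.is_module g m l" and x: "x \<in> Obj (fst g)"
  shows "lift_obj m l x \<in> Obj L" "fobj L_forget (lift_obj m l x) = fobj (fst m) x"
    "L_action (lift_obj m l x) = l x"
proof -
  obtain a y \<xi> where "fobj (fst m) x = (a, y)" "l x = (Id A a, \<xi>)" "a \<in> Obj A" "alg a y \<xi>"
    by (rule module_at[OF m x])
  then show "lift_obj m l x \<in> Obj L" "fobj L_forget (lift_obj m l x) = fobj (fst m) x"
    "L_action (lift_obj m l x) = l x"
    by (simp_all add: lift_obj_def)
qed

text \<open>An arrow over \<open>A \<times> X\<close> between the carriers of two algebras is a morphism of algebras exactly if
  it commutes with the actions.\<close>

lemma lift_hom:
  assumes m: "That.is_module g m l" and x: "x \<in> Obj (fst g)"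
    and m': "That.is_module g' m' l'" and x': "x' \<in> Obj (fst g')"
    and h: "h \<in> hom AX (fobj (fst m) x) (fobj (fst m') x')"
    and comm: "Comp AX h (l x) = Comp AX (l' x') (farr That_fun h)"
  shows "(lift_obj m l x, h, lift_obj m' l' x') \<in> hom L (lift_obj m l x) (lift_obj m' l' x')"
proof -
  obtain a y \<xi> where 1: "fobj (fst m) x = (a, y)" "l x = (Id A a, \<xi>)" "a \<in> Obj A" "alg a y \<xi>"
    by (rule module_at[OF m x])
  obtain b z \<theta> where 2: "fobj (fst m') x' = (b, z)" "l' x' = (Id A b, \<theta>)" "b \<in> Obj A" "alg b z \<theta>"
    by (rule module_at[OF m' x'])
  obtain f k where [simp]: "h = (f, k)" by (cases h)
  have "f \<in> hom A a b" "k \<in> hom X y z" using h 1 2 by simp_all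
  then show ?thesis
    using 1 2 comm by (auto simp: lift_obj_def homD(1) intro!: homI)
qed

lemma lift_farr_hom:
  assumes m: "That.is_module g m l" and f: "f \<in> hom (fst g) x y"
  shows "(lift_obj m l x, farr (fst m) f, lift_obj m l y) \<in> hom L (lift_obj m l x) (lift_obj m l y)"
proof -
  note M = That.is_moduleD[OF m]
  note F = slice_1cellD(3)[OF M(1)]
  note xy = hom_ObjD[OF functor_categoryD(1)[OF F] f]
  show ?thesis
    using nat_trans_natural[OF M(3) f] functor_hom[OF F f] homD(1)[OF f]
    by (intro lift_hom[OF m xy(1) m xy(2)]) simp_all
qed

lemma is_functor_lift:
  assumes m: "That.is_module g m l"
  shows "is_functor (fst g) L (fst (lift g m l))"
proof (rule is_functorI)
  note F = slice_1cellD(3)[OF That.is_moduleD(1)[OF m]]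
  note G = functor_categoryD(1)[OF F]
  show "category (fst g)" "category L" by (fact G category_ltimes)+
  show "fobj (fst (lift g m l)) \<in> extensional (Obj (fst g))"
    "farr (fst (lift g m l)) \<in> extensional (Arr (fst g))"
    by (simp_all add: lift_def)
  show "fobj (fst (lift g m l)) x \<in> Obj L" if "x \<in> Obj (fst g)" for x
    using that by (simp add: lift_obj[OF m])
  show "farr (fst (lift g m l)) f \<in> hom L (fobj (fst (lift g m l)) x) (fobj (fst (lift g m l)) y)"
    if f: "f \<in> hom (fst g) x y" for f x y
    using lift_farr_hom[OF m f] f hom_ObjD[OF G f] by simp
  show "farr (fst (lift g m l)) (Id (fst g) x) = Id L (fobj (fst (lift g m l)) x)"
    if x: "x \<in> Obj (fst g)" for x
  proof -
    obtain a y \<xi> where "fobj (fst m) x = (a, y)" "l x = (Id A a, \<xi>)" by (rule module_at[OF m x])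
    then show ?thesis
      using functor_Id[OF F x] by (simp add: lift_simps(2)[OF Id_in_hom[OF G x]] x lift_obj_def)
  qed
  show "farr (fst (lift g m l)) (Comp (fst g) f' f) =
      Comp L (farr (fst (lift g m l)) f') (farr (fst (lift g m l)) f)"
    if f: "f \<in> hom (fst g) x y" and f': "f' \<in> hom (fst g) y z" for f f' x y z
    using functor_Comp[OF F f f']
    by (cases "farr (fst m) f", cases "farr (fst m) f'")
      (simp add: lift_simps(2)[OF f] lift_simps(2)[OF f'] lift_simps(2)[OF Comp_in_hom[OF G f f']])
qed

lemma lift_1cell:
  assumes m: "That.is_module g m l"
  shows "slice_1cell s A g over (lift g m l)"
    and "slice_comp A g forget_cell (lift g m l) = m"
    and "rwhisk (fst g) L_action (fst (lift g m l)) = l"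
proof -
  note M = That.is_moduleD[OF m]
  note c = slice_1cellD[OF M(1)] and F = is_functor_lift[OF m]
  note G = functor_categoryD(1)[OF F]
  have forget: "functor_comp (fst g) L_forget (fst (lift g m l)) = fst m"
  proof (rule functor_eqI[OF is_functor_comp[OF F is_functor_ltimes_forget] c(3)[simplified]])
    show "fobj (functor_comp (fst g) L_forget (fst (lift g m l))) x = fobj (fst m) x"
      if "x \<in> Obj (fst g)" for x using that by (simp add: lift_obj[OF m])
    show "farr (functor_comp (fst g) L_forget (fst (lift g m l))) f = farr (fst m) f"
      if "f \<in> Arr (fst g)" for f
      using that homD(1)[OF lift_farr_hom[OF m arr_in_hom[OF that]]]
      by (simp add: lift_simps(2)[OF arr_in_hom[OF that]] del: ltimes_simps(2))
  qed
  have tri: "functor_comp (fst g) L_proj (fst (lift g m l)) = functor_comp (fst g) (proj1 A X) (fst m)"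
    using functor_comp_assoc[OF F, of "proj1 A X" L_forget] forget by (simp add: ltimes_proj_eq)
  show 1: "slice_1cell s A g over (lift g m l)"
    using M(1) F tri is_slice_obj_over by (simp add: slice_1cell_def)
  show "slice_comp A g forget_cell (lift g m l) = m"
    using forget snd_comp_forget[OF 1] by (intro prod_eqI) simp_all
  show "rwhisk (fst g) L_action (fst (lift g m l)) = l"
    by (rule extensionalityI[where A="Obj (fst g)"])
      (simp_all add: lift_obj[OF m] nat_trans_extensional[OF M(3)])
qed

lemma lift_2cell:
  assumes \<sigma>: "That.module_morphism g m l m' l' \<sigma>"
  defines "\<sigma>' \<equiv> (\<lambda>x\<in>Obj (fst g). (lift_obj m l x, \<sigma> x, lift_obj m' l' x))"
  shows "slice_2cell s A g over (lift g m l) (lift g m' l') \<sigma>'"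
    and "lwhisk (fst g) L_forget \<sigma>' = \<sigma>"
proof -
  note S = That.module_morphismD[OF \<sigma>]
  note F = is_functor_lift[OF S(1)] and F' = is_functor_lift[OF S(2)]
  have hom: "(lift_obj m l x, \<sigma> x, lift_obj m' l' x) \<in> hom L (lift_obj m l x) (lift_obj m' l' x)"
    if x: "x \<in> Obj (fst g)" for x
    using S(5)[OF x] nat_trans_hom[OF S(4) x] by (intro lift_hom[OF S(1) x S(2) x]) simp_all
  have proj: "farr L_proj (lift_obj m l x, \<sigma> x, lift_obj m' l' x) = farr (proj1 A X) (\<sigma> x)"
    if x: "x \<in> Obj (fst g)" for x
    using homD(1)[OF hom[OF x]] homD(1)[OF nat_trans_hom[OF S(4) x]]
    by (cases "\<sigma> x") (simp del: ltimes_simps(2))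
  show "slice_2cell s A g over (lift g m l) (lift g m' l') \<sigma>'"
  proof (rule slice_2cellI)
    show "slice_1cell s A g over (lift g m l)" "slice_1cell s A g over (lift g m' l')"
      using lift_1cell(1) S(1,2) by blast+
    have "nat_trans (fst g) L (fst (lift g m l)) (fst (lift g m' l')) \<sigma>'"
    proof (rule nat_transI[OF F F'])
      show "\<sigma>' x \<in> hom L (fobj (fst (lift g m l)) x) (fobj (fst (lift g m' l')) x)"
        if "x \<in> Obj (fst g)" for x using that hom by (simp add: \<sigma>'_def)
      fix f x y assume f: "f \<in> hom (fst g) x y"
      note xy = hom_ObjD[OF functor_categoryD(1)[OF F] f]
      show "Comp L (\<sigma>' y) (farr (fst (lift g m l)) f) = Comp L (farr (fst (lift g m' l')) f) (\<sigma>' x)"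
        using nat_trans_natural[OF S(4) f] xy
        by (cases "\<sigma> x", cases "\<sigma> y", cases "farr (fst m) f", cases "farr (fst m') f")
          (simp add: \<sigma>'_def lift_simps(2)[OF f])
    qed (simp add: \<sigma>'_def)
    then show "nat_trans (fst g) (fst over) (fst (lift g m l)) (fst (lift g m' l')) \<sigma>'" by simp
    have "lwhisk (fst g) L_proj \<sigma>' = lwhisk (fst g) (proj1 A X) \<sigma>"
      by (rule extensionalityI[where A="Obj (fst g)"]) (simp_all add: \<sigma>'_def proj)
    then show "vcomp (fst g) A (snd (lift g m' l')) (lwhisk (fst g) (snd over) \<sigma>') = snd (lift g m l)"
      using slice_2cellD(4)[OF S(3)] by simp
  qed
  show "lwhisk (fst g) L_forget \<sigma>' = \<sigma>"
    by (rule extensionalityI[where A="Obj (fst g)"])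
      (simp_all add: \<sigma>'_def homD(1)[OF hom] nat_trans_extensional[OF S(4)] del: ltimes_simps(2))
qed

lemma comparison_inj_on_1cells:
  assumes k: "slice_1cell s A g over k" and k': "slice_1cell s A g over k'"
    and forget: "slice_comp A g forget_cell k = slice_comp A g forget_cell k'"
    and action: "rwhisk (fst g) L_action (fst k) = rwhisk (fst g) L_action (fst k')"
  shows "k = k'"
proof (rule prod_eqI)
  note K = slice_1cellD(3)[OF k, simplified] and K' = slice_1cellD(3)[OF k', simplified]
  show "snd k = snd k'"
    using forget by (simp only: snd_comp_forget[OF k, symmetric] snd_comp_forget[OF k', symmetric])
  have eq: "functor_comp (fst g) L_forget (fst k) = functor_comp (fst g) L_forget (fst k')"
    using arg_cong[OF forget, of fst] by simp
  have obj: "fobj (fst k) x = fobj (fst k') x" if x: "x \<in> Obj (fst g)" for x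
    using fun_cong[OF arg_cong[OF eq, of fobj], of x] fun_cong[OF action, of x] x
    by (intro ltimes_Obj_eqI[OF functor_Obj[OF K x] functor_Obj[OF K' x]]) simp_all
  show "fst k = fst k'"
  proof (rule functor_eqI[OF K K' obj])
    fix f assume f: "f \<in> Arr (fst g)"
    note xy = hom_ObjD[OF functor_categoryD(1)[OF K] arr_in_hom[OF f]]
    show "farr (fst k) f = farr (fst k') f"
      using fun_cong[OF arg_cong[OF eq, of farr], of f] f functor_hom[OF K' arr_in_hom[OF f]]
        obj[OF xy(1)] obj[OF xy(2)]
      by (intro ltimes_hom_eqI[OF functor_hom[OF K arr_in_hom[OF f]]]) simp_all
  qed
qed

text \<open>A morphism of modules determines the two modules and hence, by the lemmas above, unique lifts of
  them; its components, read as arrows of \<open>A \<ltimes>\<^sup>T X\<close> between the values of these lifts, are the only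
  2-cell over it.\<close>

lemma comparison_bij:
  "bij_betw (farr (That.comparison g)) (Arr (slice_hom s A g over)) (Arr (That.Modules g))"
  unfolding bij_betw_def
proof (intro conjI equalityI subsetI)
  show "inj_on (farr (That.comparison g)) (Arr (slice_hom s A g over))"
  proof (rule inj_onI)
    fix h j assume h: "h \<in> Arr (slice_hom s A g over)" and j: "j \<in> Arr (slice_hom s A g over)"
      and eq: "farr (That.comparison g) h = farr (That.comparison g) j"
    obtain k \<sigma> k' where hk: "h = (k, \<sigma>, k')" and \<sigma>: "slice_2cell s A g over k k' \<sigma>"
      using h by (rule slice_hom_ArrE)
    obtain n \<tau> n' where jn: "j = (n, \<tau>, n')" and \<tau>: "slice_2cell s A g over n n' \<tau>"
      using j by (rule slice_hom_ArrE)
    have kn: "k = n" and kn': "k' = n'"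
      using eq \<sigma> \<tau> unfolding hk jn
      by (auto intro!: comparison_inj_on_1cells simp: slice_2cellD(1,2) simp del: slice_comp_simps)
    have \<sigma>\<tau>: "lwhisk (fst g) L_forget \<sigma> = lwhisk (fst g) L_forget \<tau>"
      using eq \<sigma> \<tau> unfolding hk jn by simp
    note s = slice_2cellD(3)[OF \<sigma>, simplified] and t = slice_2cellD(3)[OF \<tau>, folded kn kn', simplified]
    have "\<sigma> = \<tau>"
    proof (rule extensionalityI[OF nat_trans_extensional[OF s] nat_trans_extensional[OF t]])
      show "\<sigma> x = \<tau> x" if x: "x \<in> Obj (fst g)" for x
        using fun_cong[OF \<sigma>\<tau>, of x] x
        by (intro ltimes_hom_eqI[OF nat_trans_hom[OF s x] nat_trans_hom[OF t x]]) simp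
    qed
    then show "h = j" using hk jn kn kn' by simp
  qed
  fix h
  show "h \<in> Arr (That.Modules g)" if "h \<in> farr (That.comparison g) ` Arr (slice_hom s A g over)"
    using that functor_Arr[OF That.is_functor_comparison] by blast
  assume "h \<in> Arr (That.Modules g)"
  then obtain m l \<sigma> m' l' where h: "h = ((m, l), \<sigma>, (m', l'))" "That.module_morphism g m l m' l' \<sigma>"
    by (rule That.Modules_ArrE)
  note S = That.module_morphismD(1,2)[OF h(2)] and \<sigma>' = lift_2cell[OF h(2)]
  show "h \<in> farr (That.comparison g) ` Arr (slice_hom s A g over)"
  proof (rule image_eqI)
    let ?j = "(lift g m l, \<lambda>x\<in>Obj (fst g). (lift_obj m l x, \<sigma> x, lift_obj m' l' x), lift g m' l')"
    show "h = farr (That.comparison g) ?j"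
      using h \<sigma>' lift_1cell(2,3)[OF S(1)] lift_1cell(2,3)[OF S(2)] by simp
    show "?j \<in> Arr (slice_hom s A g over)" using \<sigma>' by simp
  qed
qed

end

section \<open>Comparison with the algebras of the monad on the product category\<close>

lemma EM_simps [simp]:
  "(x, \<xi>) \<in> Obj (EM C M) \<longleftrightarrow> EM_algebra C M x \<xi>"
  "((x, \<xi>), h, (y, \<theta>)) \<in> Arr (EM C M) \<longleftrightarrow> EM_algebra C M x \<xi> \<and> EM_algebra C M y \<theta> \<and>
     h \<in> hom C x y \<and> Comp C h \<xi> = Comp C \<theta> (farr (mfun M) h)"
  "Dom (EM C M) (p, h, q) = p"
  "Cod (EM C M) (p, h, q) = q"
  "Id (EM C M) (x, \<xi>) = ((x, \<xi>), Id C x, (x, \<xi>))"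
  "Comp (EM C M) (q, k, r) (p, h, q') = (p, Comp C k h, r)"
  by (simp_all add: EM_def)

lemma EM_ArrE:
  assumes "h \<in> Arr (EM C M)"
  obtains x \<xi> f y \<theta> where "h = ((x, \<xi>), f, (y, \<theta>))"
    "EM_algebra C M x \<xi>" "EM_algebra C M y \<theta>" "f \<in> hom C x y" "Comp C f \<xi> = Comp C \<theta> (farr (mfun M) f)"
  using assms unfolding EM_def by auto

lemma EM_algebraD:
  assumes "EM_algebra C M x \<xi>"
  shows "x \<in> Obj C" "\<xi> \<in> hom C (fobj (mfun M) x) x"
  using assms by (auto simp: EM_algebra_def)

lemma EM_Id_in_Arr:
  assumes M: "is_functor C C (mfun M)" and x: "EM_algebra C M x \<xi>"
  shows "((x, \<xi>), Id C x, (x, \<xi>)) \<in> Arr (EM C M)"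
  using x EM_algebraD[OF x] functor_categoryD(1)[OF M] functor_Id[OF M]
  by (simp add: Id_in_hom Comp_Id_left Comp_Id_right)

lemma EM_Comp_in_Arr:
  assumes M: "is_functor C C (mfun M)"
    and h: "((x, \<xi>), h, (y, \<theta>)) \<in> Arr (EM C M)" and k: "((y, \<theta>), k, (z, \<zeta>)) \<in> Arr (EM C M)"
  shows "((x, \<xi>), Comp C k h, (z, \<zeta>)) \<in> Arr (EM C M)"
proof -
  note C = functor_categoryD(1)[OF M]
  have *: "h \<in> hom C x y" "k \<in> hom C y z"
    "Comp C h \<xi> = Comp C \<theta> (farr (mfun M) h)" "Comp C k \<theta> = Comp C \<zeta> (farr (mfun M) k)"
    and \<xi>: "\<xi> \<in> hom C (fobj (mfun M) x) x" and \<theta>: "\<theta> \<in> hom C (fobj (mfun M) y) y"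
    and \<zeta>: "\<zeta> \<in> hom C (fobj (mfun M) z) z"
    using h k by (auto dest: EM_algebraD)
  note Mh = functor_hom[OF M *(1)] and Mk = functor_hom[OF M *(2)]
  have "Comp C (Comp C k h) \<xi> = Comp C (Comp C k \<theta>) (farr (mfun M) h)"
    using Comp_assoc[OF C \<xi> *(1,2)] Comp_assoc[OF C Mh \<theta> *(2)] *(3) by simp
  also have "\<dots> = Comp C \<zeta> (farr (mfun M) (Comp C k h))"
    using Comp_assoc[OF C Mh Mk \<zeta>] *(4) functor_Comp[OF M *(1,2)] by simp
  finally show ?thesis using h k Comp_in_hom[OF C *(1,2)] by simp
qed

lemma category_EM:
  assumes M: "is_functor C C (mfun M)"
  shows "category (EM C M)"
proof (rule categoryI)
  note C = functor_categoryD(1)[OF M]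
  fix h assume h: "h \<in> Arr (EM C M)"
  then show "Dom (EM C M) h \<in> Obj (EM C M)" "Cod (EM C M) h \<in> Obj (EM C M)"
    by (auto elim!: EM_ArrE)
  from h show "Comp (EM C M) h (Id (EM C M) (Dom (EM C M) h)) = h"
    "Comp (EM C M) (Id (EM C M) (Cod (EM C M) h)) h = h"
    by (auto elim!: EM_ArrE simp: Comp_Id_left[OF C] Comp_Id_right[OF C])
  fix k assume k: "k \<in> Arr (EM C M)" "Dom (EM C M) k = Cod (EM C M) h"
  with h show "Comp (EM C M) k h \<in> hom (EM C M) (Dom (EM C M) h) (Cod (EM C M) k)"
    by (auto elim!: EM_ArrE intro!: homI EM_Comp_in_Arr[OF M] simp del: EM_simps(2)) auto
  fix j assume "j \<in> Arr (EM C M)" "Dom (EM C M) j = Cod (EM C M) k"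
  with h k show "Comp (EM C M) j (Comp (EM C M) k h) = Comp (EM C M) (Comp (EM C M) j k) h"
    by (auto elim!: EM_ArrE intro: Comp_assoc[OF C])
next
  fix p assume "p \<in> Obj (EM C M)"
  then show "Id (EM C M) p \<in> hom (EM C M) p p"
    using EM_Id_in_Arr[OF M] by (cases p) (auto intro!: homI simp del: EM_simps(2))
qed

lemma EM_forget_simps [simp]:
  "EM_algebra C M x \<xi> \<Longrightarrow> fobj (EM_forget C M) (x, \<xi>) = x"
  "(p, h, q) \<in> Arr (EM C M) \<Longrightarrow> farr (EM_forget C M) (p, h, q) = h"
  by (simp_all add: EM_forget_def)

lemma is_functor_EM_forget:
  assumes M: "is_functor C C (mfun M)"
  shows "is_functor (EM C M) C (EM_forget C M)"
proof (rule is_functorI[OF category_EM[OF M] functor_categoryD(1)[OF M]])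
  show "fobj (EM_forget C M) \<in> extensional (Obj (EM C M))" "farr (EM_forget C M) \<in> extensional (Arr (EM C M))"
    by (simp_all add: EM_forget_def)
  show "fobj (EM_forget C M) p \<in> Obj C" if "p \<in> Obj (EM C M)" for p
    using that by (cases p) (auto dest: EM_algebraD)
  show "farr (EM_forget C M) h \<in> hom C (fobj (EM_forget C M) p) (fobj (EM_forget C M) q)"
    if "h \<in> hom (EM C M) p q" for h p q
    using that homD[OF that] by (auto elim!: EM_ArrE)
  show "farr (EM_forget C M) (Id (EM C M) p) = Id C (fobj (EM_forget C M) p)" if "p \<in> Obj (EM C M)" for p
    using that EM_Id_in_Arr[OF M] by (cases p) (simp del: EM_simps(2))
  show "farr (EM_forget C M) (Comp (EM C M) k h) = Comp C (farr (EM_forget C M) k) (farr (EM_forget C M) h)"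
    if h: "h \<in> hom (EM C M) p q" and k: "k \<in> hom (EM C M) q r" for h k p q r
    using homD(1)[OF h] homD(1)[OF k] homD(1)[OF Comp_in_hom[OF category_EM[OF M] h k]]
    by (cases h, cases k) (simp del: EM_simps(2))
qed

context parametrized_monad_on
begin

text \<open>The unit of the monad is \<open>(id, \<eta>)\<close>, so the unit law forces the first component of a structure
  map to be an identity.\<close>

lemma EM_algebra_That_iff:
  "EM_algebra AX (That A X T) (a, x) (i, \<xi>) \<longleftrightarrow> a \<in> Obj A \<and> i = Id A a \<and> alg a x \<xi>"
proof
  assume *: "EM_algebra AX (That A X T) (a, x) (i, \<xi>)"
  then have ax: "a \<in> Obj A" "x \<in> Obj X" by (auto simp: EM_algebra_def)
  then have hom: "i \<in> hom A a a" "\<xi> \<in> hom X (fobj (End a) x) x"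
    and unit: "Comp A i (Id A a) = Id A a" "Comp X \<xi> (unit_at a x) = Id X x"
    using * by (auto simp: EM_algebra_def)
  have i: "i = Id A a" using unit(1) Comp_Id_right[OF A hom(1)] by simp
  have "Comp X \<xi> (mult_at a x) = Comp X \<xi> (farr (End a) \<xi>)"
    using * ax hom i
    by (simp add: EM_algebra_def homD(1)[OF Id_in_hom[OF A]] homD(1)[OF hom(2)] pm_map_Id_left[OF _ hom(2)])
  then show "a \<in> Obj A \<and> i = Id A a \<and> alg a x \<xi>"
    using ax hom unit i by (simp add: EM_algebra_def)
next
  assume "a \<in> Obj A \<and> i = Id A a \<and> alg a x \<xi>"
  then have a: "a \<in> Obj A" and i: "i = Id A a" and \<xi>: "alg a x \<xi>" by auto
  show "EM_algebra AX (That A X T) (a, x) (i, \<xi>)"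
    using a i algD[OF \<xi>]
    by (simp add: EM_algebra_def Id_in_hom[OF A] Comp_Id_left[OF A Id_in_hom[OF A]]
        homD(1)[OF Id_in_hom[OF A]] homD(1)[OF algD(2)[OF \<xi>]] pm_map_Id_left[OF _ algD(2)[OF \<xi>]])
qed

abbreviation EMT where "EMT \<equiv> EM AX (That A X T)"
abbreviation EMT_forget where "EMT_forget \<equiv> EM_forget AX (That A X T)"

definition to_EM_obj where "to_EM_obj = (\<lambda>(a, x, \<xi>). ((a, x), (Id A a, \<xi>)))"

definition to_EM where
  "to_EM = \<lparr>fobj = (\<lambda>p\<in>Obj L. to_EM_obj p),
            farr = (\<lambda>(p, h, q)\<in>Arr L. (to_EM_obj p, h, to_EM_obj q))\<rparr>"

lemma to_EM_Obj_iff: "to_EM_obj p \<in> Obj EMT \<longleftrightarrow> p \<in> Obj L"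
  by (cases p) (auto simp: to_EM_obj_def EM_algebra_That_iff)

lemma to_EM_Arr_iff: "(to_EM_obj p, h, to_EM_obj q) \<in> Arr EMT \<longleftrightarrow> (p, h, q) \<in> Arr L"
proof -
  obtain a x \<xi> f g b y \<theta> where [simp]: "p = (a, x, \<xi>)" "h = (f, g)" "q = (b, y, \<theta>)"
    by (cases p, cases h, cases q)
  show ?thesis
    by (auto simp: to_EM_obj_def EM_algebra_That_iff homD(1) Comp_Id_left[OF A] Comp_Id_right[OF A])
qed

lemma EMT_ObjE:
  assumes "r \<in> Obj EMT"
  obtains p where "r = to_EM_obj p" "p \<in> Obj L"
proof -
  obtain a x i \<xi> where r: "r = ((a, x), (i, \<xi>))" by (cases r) auto
  then have "r = to_EM_obj (a, x, \<xi>)"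
    using assms by (simp add: to_EM_obj_def EM_algebra_That_iff)
  then show ?thesis using that assms to_EM_Obj_iff by metis
qed

lemma to_EM_simps [simp]:
  "p \<in> Obj L \<Longrightarrow> fobj to_EM p = to_EM_obj p"
  "(p, h, q) \<in> Arr L \<Longrightarrow> farr to_EM (p, h, q) = (to_EM_obj p, h, to_EM_obj q)"
  by (simp_all add: to_EM_def)

lemma is_functor_to_EM: "is_functor L EMT to_EM"
proof (rule is_functorI[OF category_ltimes category_EM[OF is_functor_That]])
  show "fobj to_EM \<in> extensional (Obj L)" "farr to_EM \<in> extensional (Arr L)"
    by (simp_all add: to_EM_def)
  show "fobj to_EM p \<in> Obj EMT" if "p \<in> Obj L" for p
    using that by (simp add: to_EM_Obj_iff)
  show "farr to_EM h \<in> hom EMT (fobj to_EM p) (fobj to_EM q)" if h: "h \<in> hom L p q" for h p q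
    using homD[OF h] hom_ObjD[OF category_ltimes h]
    by (cases h) (auto intro!: homI simp: to_EM_Arr_iff simp del: ltimes_simps(1,2) EM_simps(1,2))
  show "farr to_EM (Id L p) = Id EMT (fobj to_EM p)" if "p \<in> Obj L" for p
    using that homD(1)[OF Id_in_hom[OF category_ltimes that]]
    by (cases p) (simp add: to_EM_obj_def del: ltimes_simps(2))
  show "farr to_EM (Comp L k h) = Comp EMT (farr to_EM k) (farr to_EM h)"
    if h: "h \<in> hom L p q" and k: "k \<in> hom L q r" for h k p q r
    using homD(1)[OF h] homD(1)[OF k] homD(1)[OF Comp_in_hom[OF category_ltimes h k]]
    by (cases h, cases k, cases "fst (snd h)", cases "fst (snd k)") (simp del: ltimes_simps(2))
qed

lemma cat_isomorphism_to_EM: "cat_isomorphism L EMT to_EM"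
proof (rule cat_isomorphism_if_bij_on_arrows[OF is_functor_to_EM])
  have inj: "to_EM_obj p = to_EM_obj q \<Longrightarrow> p = q" for p q
    by (cases p, cases q) (simp add: to_EM_obj_def)
  show "bij_betw (farr to_EM) (Arr L) (Arr EMT)"
    unfolding bij_betw_def
  proof (intro conjI equalityI subsetI)
    show "inj_on (farr to_EM) (Arr L)"
    proof (rule inj_onI)
      fix h k assume "h \<in> Arr L" "k \<in> Arr L" "farr to_EM h = farr to_EM k"
      then show "h = k"
        by (cases h, cases k) (auto dest!: inj simp del: ltimes_simps(2))
    qed
    fix r
    show "r \<in> Arr EMT" if "r \<in> farr to_EM ` Arr L"
      using that functor_Arr[OF is_functor_to_EM] by blast
    assume r: "r \<in> Arr EMT"
    obtain p' h q' where r': "r = (p', h, q')" by (cases r)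
    have "p' \<in> Obj EMT" "q' \<in> Obj EMT"
      using hom_ObjD[OF category_EM[OF is_functor_That] arr_in_hom[OF r]] r' by simp_all
    then obtain p q where pq: "p' = to_EM_obj p" "q' = to_EM_obj q" by (metis EMT_ObjE)
    then have h: "(p, h, q) \<in> Arr L" using r r' by (simp only: to_EM_Arr_iff)
    then show "r \<in> farr to_EM ` Arr L"
      using r' pq by (intro image_eqI[of _ _ "(p, h, q)"]) (simp_all del: ltimes_simps(2))
  qed
qed

lemma ltimes_equivalent_EM:
  "slice_equivalent s A over (EMT, functor_comp EMT (proj1 A X) EMT_forget)"
proof (rule slice_equivalent_if_cat_isomorphism[where F = to_EM])
  have EMf: "is_functor EMT AX EMT_forget" by (rule is_functor_EM_forget[OF is_functor_That])
  show "is_slice_obj A over" by (rule is_slice_obj_over)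
  show "is_slice_obj A (EMT, functor_comp EMT (proj1 A X) EMT_forget)"
    by (simp add: is_slice_obj_def is_functor_comp[OF EMf is_functor_proj1[OF A X]])
  show "cat_isomorphism (fst over) (fst (EMT, functor_comp EMT (proj1 A X) EMT_forget)) to_EM"
    by (simp add: cat_isomorphism_to_EM)
  have "functor_comp L EMT_forget to_EM = L_forget"
  proof (rule functor_eqI[OF is_functor_comp[OF is_functor_to_EM EMf] is_functor_ltimes_forget])
    show "fobj (functor_comp L EMT_forget to_EM) p = fobj L_forget p" if "p \<in> Obj L" for p
      using that to_EM_Obj_iff[of p] by (cases p) (simp add: to_EM_obj_def)
    show "farr (functor_comp L EMT_forget to_EM) h = farr L_forget h" if "h \<in> Arr L" for h
      using that by (cases h) (simp add: to_EM_Arr_iff del: ltimes_simps(2) EM_simps(2))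
  qed
  then show "functor_comp (fst over) (snd (EMT, functor_comp EMT (proj1 A X) EMT_forget)) to_EM = snd over"
    using functor_comp_assoc[OF is_functor_to_EM, of "proj1 A X" EMT_forget] ltimes_proj_eq by simp
qed

end

theorem theorem3p1:
  fixes A :: "('a, 'f) cat" and X :: "('x, 'm) cat" and T :: "('a, 'f, 'x, 'm) param_monad"
    and s :: slice_kind
  assumes "category A" and "category X" and "parametrized_monad A X T"
  shows "slice_equivalent s A
           (ltimes A X T, ltimes_proj A X T)
           (EM (prod_cat A X) (That A X T),
            functor_comp (EM (prod_cat A X) (That A X T)) (proj1 A X) (EM_forget (prod_cat A X) (That A X T)))
       \<and> is_EM_object TYPE('g \<times> 'h) TYPE('k \<times> 'l) s A
           (prod_cat A X, proj1 A X)
           (mfun (That A X T), nat_id (prod_cat A X) A (proj1 A X))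
           (munit (That A X T)) (mmult (That A X T))
           (ltimes A X T, ltimes_proj A X T)
           (ltimes_forget A X T, nat_id (ltimes A X T) A (ltimes_proj A X T))
           (ltimes_action A X T)"
proof -
  interpret parametrized_monad_slice A X T s
    by unfold_locales (use assms in auto)
  show ?thesis
    using ltimes_equivalent_EM That.is_EM_object_if_comparison_bij[OF comparison_bij] by blast
qed

end
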